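(* There exists a constant $c > 0$ such that for every integer $p \geq 1$ there exists $\Delta_p$ such that for all $\Delta \geq \Delta_p$ there exists a graph $G$ of maximum degree at most $\Delta$ such that every $p$-centered coloring of $G$ requires (i.e. uses) at least $c \cdot \Delta^{2-1/p}\, p\, (\ln \Delta)^{-1/p}$ colors.
   Context: Graphs are finite and simple. Connected subgraphs are nonempty. Given a graph $G$ and an integer $p$, a coloring $f : V(G) \to \mathbb{N}$ is $p$-centered if for every connected subgraph $H$ of $G$, either $|f(V(H))| > p$, or there exists $i \in \mathbb{N}$ such that $|f^{-1}(i) \cap V(H)| = 1$. The number of colors used by $f$ is $|f(V(G))|$. Here $\Delta$ ranges over integers. *)

theory Defs
  imports Complex_Main "Graph_Theory.Graph_Theory"
begin

text \<open>
  A finite simple graph is a \<^locale>\<open>pair_graph\<close>: the edge \<open>uv\<close> is the pair of arcs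
  \<open>(u, v)\<close> and \<open>(v, u)\<close>, so the degree of a vertex is its out-degree.
\<close>

definition max_degree :: "'a pair_pre_digraph \<Rightarrow> nat" where
  \<comment> \<open>the graph without vertices gets maximum degree 0\<close>
  "max_degree G = Max (insert 0 (out_degree (with_proj G) ` pverts G))"

text \<open>
  \<open>subgraph\<close> alone would admit subdigraphs that are not symmetric, hence the condition
  \<open>pair_graph H\<close>.  A \<open>Digraph_Component.connected\<close> graph has at least one vertex.
\<close>

definition connected_subgraph :: "'a pair_pre_digraph \<Rightarrow> 'a pair_pre_digraph \<Rightarrow> bool" where
  "connected_subgraph H G \<longleftrightarrow>
     pair_graph H \<and> subgraph (with_proj H) (with_proj G) \<and>
     Digraph_Component.connected (with_proj H)"

text \<open>
  A coloring of \<open>G\<close> is a total function of which only the values on \<open>pverts G\<close> matter.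
\<close>

definition p_centered :: "int \<Rightarrow> 'a pair_pre_digraph \<Rightarrow> ('a \<Rightarrow> nat) \<Rightarrow> bool" where
  "p_centered p G f \<longleftrightarrow>
     (\<forall>H. connected_subgraph H G \<longrightarrow>
        int (card (f ` pverts H)) > p \<or> (\<exists>i. card (f -` {i} \<inter> pverts H) = 1))"

definition num_colors :: "'a pair_pre_digraph \<Rightarrow> ('a \<Rightarrow> nat) \<Rightarrow> nat" where
  "num_colors G f = card (f ` pverts G)"

end

theory Submission
  imports Defs "HOL-Library.FuncSet" "HOL-Real_Asymp.Real_Asymp"
begin

text \<open>
  The graph is random.  A coloring of \<open>3 * m\<close> vertices with at most \<open>m\<close> colors contains \<open>m\<close>
  disjoint monochromatic pairs \<open>(a i, b i)\<close> (\<open>monochromatic_pairs\<close>).  A tree whose \<open>2 * p\<close> vertices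
  are made up of \<open>p\<close> of these pairs has at most \<open>p\<close> colors, none of them on exactly one
  vertex, so it shows that the coloring is not \<open>p\<close>-centered (\<open>tree_obstructs_centered\<close>).  It therefore
  suffices that, with positive probability, every choice of \<open>m\<close> disjoint pairs has such a tree and
  no degree exceeds \<open>\<Delta>\<close>.

  Join vertices with probability of order \<open>q = \<Delta> / (72 * m)\<close>.  There are about \<open>m ^ p\<close> ways to place
  \<open>p\<close> pairs along a path through the \<open>a\<close>-vertices and, for each of them, about \<open>(p / 2) ^ p\<close> ways to
  attach the \<open>b\<close>-vertices as leaves to the path; the resulting tree has \<open>2 * p - 1\<close> edges.  If
  these trees occur almost independently of each other, then the probability that none of them is
  present is at most \<open>exp (- q ^ (2 * p - 1) * (m * p / C) ^ p)\<close> for a constant \<open>C\<close>.  There are at most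
  \<open>(3 * m) ^ (2 * m)\<close> choices of pairs, so the union bound needs \<open>q ^ (2 * p - 1) * (m * p / C) ^ p\<close> to be
  a multiple of \<open>m * ln m\<close>.  With \<open>q\<close> of order \<open>\<Delta> / m\<close> and \<open>ln m\<close> of order \<open>ln \<Delta>\<close>, this says
  that \<open>m\<close> may be as large as a constant times \<open>p * \<Delta> powr (2 - 1 / p) * ln \<Delta> powr (- 1 / p)\<close>.
  The factor \<open>p\<close> comes from the number of attachments.

  The bound on the probability that no tree is present is a form of Janson's inequality
  (\<open>subset_prob_avoid_family\<close>).  It requires that a given tree rarely meets another one that is
  present.  If the two trees have \<open>k\<close> pairs in common, the other \<open>p - k\<close> pairs can be chosen in
  at most \<open>m ^ (p - k)\<close> ways, and here \<open>m * q ^ 2\<close> is large; the count is only small if the \<open>k\<close> common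
  pairs span at most \<open>2 * k - 2\<close> edges, that is, if they do not already form a subtree.  The
  attachments are restricted so that no proper nonempty set of pairs of a tree spans a subtree
  (\<open>no_small_subtree\<close>); the restriction leaves enough of them.

  For \<open>p = 1\<close> the complete graph on \<open>\<Delta> + 1\<close> vertices suffices.
\<close>

section \<open>Random subsets of a finite set\<close>

text \<open>
  The probability that a random subset of \<open>E\<close>, which contains every element independently with
  probability \<open>q\<close>, has the property \<open>P\<close>.
\<close>

definition subset_prob :: "'a set \<Rightarrow> real \<Rightarrow> ('a set \<Rightarrow> bool) \<Rightarrow> real" where
  "subset_prob E q P = (\<Sum>S\<in>Pow E. of_bool (P S) * (q ^ card S * (1 - q) ^ card (E - S)))"

lemma subset_prob_cong:
  assumes "\<And>S. S \<subseteq> E \<Longrightarrow> P S = Q S"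
  shows "subset_prob E q P = subset_prob E q Q"
  unfolding subset_prob_def using assms by (intro sum.cong) auto

lemma subset_prob_insert:
  assumes "finite E" "e \<notin> E"
  shows "subset_prob (insert e E) q P =
    q * subset_prob E q (\<lambda>S. P (insert e S)) + (1 - q) * subset_prob E q P"
proof -
  let ?w = "\<lambda>S. of_bool (P S) * (q ^ card S * (1 - q) ^ card (insert e E - S))"
  have inj: "inj_on (insert e) (Pow E)"
    using assms(2) by (auto simp: inj_on_def)
  have disj: "Pow E \<inter> insert e ` Pow E = {}"
    using assms(2) by auto
  have "subset_prob (insert e E) q P = sum ?w (Pow E) + sum ?w (insert e ` Pow E)"
    unfolding subset_prob_def Pow_insert using assms disj by (subst sum.union_disjoint) auto
  moreover have "sum ?w (Pow E) = (1 - q) * subset_prob E q P"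
    unfolding subset_prob_def sum_distrib_left
  proof (rule sum.cong)
    fix S assume "S \<in> Pow E"
    then have "insert e E - S = insert e (E - S)" "finite (E - S)" "e \<notin> E - S"
      using assms by auto
    then show "?w S = (1 - q) * (of_bool (P S) * (q ^ card S * (1 - q) ^ card (E - S)))"
      by simp
  qed simp
  moreover have "sum ?w (insert e ` Pow E) = q * subset_prob E q (\<lambda>S. P (insert e S))"
    unfolding subset_prob_def sum_distrib_left sum.reindex[OF inj] o_def
  proof (rule sum.cong)
    fix S assume "S \<in> Pow E"
    then have "insert e E - insert e S = E - S" "finite S" "e \<notin> S"
      using assms finite_subset by auto
    then show "?w (insert e S)
        = q * (of_bool (P (insert e S)) * (q ^ card S * (1 - q) ^ card (E - S)))"
      by simp
  qed simp
  ultimately show ?thesis by simp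
qed

lemma subset_prob_True: "finite E \<Longrightarrow> subset_prob E q (\<lambda>_. True) = 1"
proof (induction E rule: finite_induct)
  case empty
  show ?case by (simp add: subset_prob_def)
next
  case (insert e E)
  then show ?case by (simp add: subset_prob_insert)
qed

lemma subset_prob_False: "subset_prob E q (\<lambda>_. False) = 0"
  by (simp add: subset_prob_def)

lemma subset_prob_superset:
  assumes "finite E" "F \<subseteq> E"
  shows "subset_prob E q (\<lambda>S. F \<subseteq> S \<and> P S)
    = q ^ card F * subset_prob (E - F) q (\<lambda>S. P (S \<union> F))"
proof -
  have "finite F" using assms finite_subset by blast
  then show ?thesis using assms
  proof (induction F arbitrary: E P rule: finite_induct)
    case empty
    show ?case by simp
  next
    case (insert f F)
    define D where "D = E - {f}"
    have D: "finite D" "f \<notin> D" "E = insert f D" "F \<subseteq> D" "E - insert f F = D - F"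
      using insert.prems insert.hyps by (auto simp: D_def)
    have 1: "subset_prob D q (\<lambda>S. insert f F \<subseteq> insert f S \<and> P (insert f S))
      = subset_prob D q (\<lambda>S. F \<subseteq> S \<and> P (insert f S))"
      using insert.hyps by (intro subset_prob_cong) auto
    have 2: "subset_prob D q (\<lambda>S. insert f F \<subseteq> S \<and> P S) = 0"
      using D subset_prob_False[of D q] by (subst subset_prob_cong[of _ _ "\<lambda>_. False"]) auto
    have "subset_prob E q (\<lambda>S. insert f F \<subseteq> S \<and> P S)
      = q * subset_prob D q (\<lambda>S. F \<subseteq> S \<and> P (insert f S))"
      unfolding D(3) using subset_prob_insert[OF D(1,2)] 1 2 by simp
    also have "\<dots> = q * (q ^ card F * subset_prob (D - F) q (\<lambda>S. P (insert f (S \<union> F))))"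
      using insert.IH[OF D(1,4), of "\<lambda>S. P (insert f S)"] by simp
    finally show ?case using insert.hyps D by simp
  qed
qed

lemma subset_prob_irrelevant:
  assumes "finite E" "finite F" "E \<inter> F = {}" "\<And>S T. T \<subseteq> F \<Longrightarrow> P (S \<union> T) = P S"
  shows "subset_prob (E \<union> F) q P = subset_prob E q P"
  using assms(2,3,4)
proof (induction F rule: finite_induct)
  case empty
  show ?case by simp
next
  case (insert f F)
  have "P (insert f S) = P S" for S
    using insert.prems(2)[of "{f}" S] by simp
  then have "subset_prob (insert f (E \<union> F)) q P = subset_prob (E \<union> F) q P"
    using insert assms(1) by (subst subset_prob_insert) (auto simp: algebra_simps)
  also have "\<dots> = subset_prob E q P"
    using insert.IH insert.prems by (metis Int_insert_right_if1 insert_disjoint(2) order_trans subset_insertI inf_commute)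
  finally show ?case by simp
qed

context
  fixes q :: real
  assumes q0: "0 \<le> q" and q1: "q \<le> 1"
begin

lemma subset_prob_nonneg: "0 \<le> subset_prob E q P"
  unfolding subset_prob_def using q0 q1 by (intro sum_nonneg) auto

lemma subset_prob_mono:
  assumes "finite E" "\<And>S. S \<subseteq> E \<Longrightarrow> P S \<Longrightarrow> Q S"
  shows "subset_prob E q P \<le> subset_prob E q Q"
  unfolding subset_prob_def using q0 q1 assms(2)
  by (intro sum_mono mult_right_mono) auto

lemma subset_prob_disj:
  "subset_prob E q (\<lambda>S. P S \<or> Q S) \<le> subset_prob E q P + subset_prob E q Q"
  unfolding subset_prob_def sum.distrib[symmetric] using q0 q1
  by (intro sum_mono) auto

lemma subset_prob_Bex:
  assumes "finite I"
  shows "subset_prob E q (\<lambda>S. \<exists>i\<in>I. P i S) \<le> (\<Sum>i\<in>I. subset_prob E q (P i))"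
  using assms
proof (induction I rule: finite_induct)
  case empty
  show ?case by (simp add: subset_prob_False)
next
  case (insert i I)
  have "subset_prob E q (\<lambda>S. \<exists>j\<in>insert i I. P j S)
    \<le> subset_prob E q (P i) + subset_prob E q (\<lambda>S. \<exists>j\<in>I. P j S)"
    using subset_prob_disj[of E "P i" "\<lambda>S. \<exists>j\<in>I. P j S"] by simp
  then show ?case using insert by simp
qed

lemma subset_prob_ex:
  assumes "finite E" "subset_prob E q P < 1"
  shows "\<exists>S\<subseteq>E. \<not> P S"
proof (rule ccontr)
  assume "\<not> ?thesis"
  then have "subset_prob E q P = subset_prob E q (\<lambda>_. True)"
    by (intro subset_prob_cong) auto
  then show False using assms subset_prob_True by force
qed

text \<open>
  The instance of Harris' inequality in which the increasing event is that certain elements are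
  present: conditioned on them, a decreasing property becomes at most less likely.
\<close>

lemma subset_prob_superset_antimono:
  assumes "finite E" "F \<subseteq> E" and anti: "\<And>S T. S \<subseteq> T \<Longrightarrow> P T \<Longrightarrow> P S"
  shows "subset_prob E q (\<lambda>S. F \<subseteq> S \<and> P S) \<le> q ^ card F * subset_prob E q P"
proof -
  have gen: "subset_prob D q (\<lambda>S. P (S \<union> F)) \<le> subset_prob (D \<union> F) q P"
    if "finite F" "finite D" "D \<inter> F = {}" "\<And>S T. S \<subseteq> T \<Longrightarrow> P T \<Longrightarrow> P S"
    for D F :: "'a set" and P
    using that
  proof (induction F arbitrary: P rule: finite_induct)
    case empty
    show ?case by simp
  next
    case (insert f F)
    let ?P = "\<lambda>S. P (insert f S)"
    have 1: "subset_prob D q (\<lambda>S. ?P (S \<union> F)) \<le> subset_prob (D \<union> F) q ?P"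
      using insert.prems by (intro insert.IH) (auto intro: insert.prems(3)[OF insert_mono])
    have 2: "subset_prob (D \<union> F) q ?P \<le> subset_prob (D \<union> F) q P"
      using insert by (intro subset_prob_mono) (auto intro: insert.prems(3))
    have "subset_prob (insert f (D \<union> F)) q P
      = q * subset_prob (D \<union> F) q ?P + (1 - q) * subset_prob (D \<union> F) q P"
      using insert by (intro subset_prob_insert) auto
    moreover have "(1 - q) * subset_prob (D \<union> F) q ?P \<le> (1 - q) * subset_prob (D \<union> F) q P"
      using 2 q1 by (intro mult_left_mono) auto
    ultimately show ?case using 1 by (simp add: algebra_simps)
  qed
  have F: "finite F" "E - F \<union> F = E"
    using assms finite_subset by auto
  show ?thesis
    using gen[of F "E - F" P] assms F q0
    by (subst subset_prob_superset) (auto intro!: mult_left_mono)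
qed

text \<open>
  A form of Janson's inequality: up to the factor \<open>1 / 2\<close>, the events \<open>A \<subseteq> S\<close> behave as if they were
  independent, provided that, given \<open>A \<subseteq> S\<close>, the expected number of other members of the family
  that meet \<open>A\<close> and are present is at most \<open>1 / 2\<close>.

  The members are added one at a time.  Those disjoint from the new member \<open>A\<close> are independent of
  it, so the event that they are all absent does not change the probability of \<open>A \<subseteq> S\<close>; and that
  event is decreasing, so conditioning on it does not increase the probability that \<open>A\<close> is present
  together with one of those that meet it.
\<close>

lemma subset_prob_avoid_family:
  assumes "finite E" "finite \<F>" "\<And>A. A \<in> \<F> \<Longrightarrow> A \<subseteq> E"
    and overlap: "\<And>A. A \<in> \<F> \<Longrightarrow> (\<Sum>B | B \<in> \<F> \<and> B \<noteq> A \<and> A \<inter> B \<noteq> {}. q ^ card (B - A)) \<le> 1 / 2"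
  shows "subset_prob E q (\<lambda>S. \<forall>A\<in>\<F>. \<not> A \<subseteq> S) \<le> (\<Prod>A\<in>\<F>. 1 - q ^ card A / 2)"
  using assms(2,3) overlap
proof (induction \<F> rule: finite_induct)
  case empty
  show ?case using assms(1) by (simp add: subset_prob_True)
next
  case (insert A \<F>)
  define none where "none J S \<longleftrightarrow> (\<forall>B\<in>J. \<not> B \<subseteq> S)" for J and S :: "'a set"
  define J1 where "J1 = {B\<in>\<F>. A \<inter> B \<noteq> {}}"
  define J0 where "J0 = {B\<in>\<F>. A \<inter> B = {}}"
  let ?p = "subset_prob E q"
  have AE: "A \<subseteq> E" using insert.prems(1) by simp
  then have fin: "finite J1" "finite A"
    using insert.hyps assms(1) by (auto simp: J1_def dest: finite_subset)
  have J: "J1 = {B. B \<in> insert A \<F> \<and> B \<noteq> A \<and> A \<inter> B \<noteq> {}}"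
    using insert by (auto simp: J1_def)
  have anti: "none J S" if "S \<subseteq> T" "none J T" for J S T
    using that by (auto simp: none_def)
  have IH: "?p (none \<F>) \<le> (\<Prod>A\<in>\<F>. 1 - q ^ card A / 2)"
    unfolding none_def
  proof (rule insert.IH)
    fix B assume B: "B \<in> \<F>"
    have "(\<Sum>C | C \<in> \<F> \<and> C \<noteq> B \<and> B \<inter> C \<noteq> {}. q ^ card (C - B))
      \<le> (\<Sum>C | C \<in> insert A \<F> \<and> C \<noteq> B \<and> B \<inter> C \<noteq> {}. q ^ card (C - B))"
      using insert.hyps q0 by (intro sum_mono2) auto
    also have "\<dots> \<le> 1 / 2" using B by (intro insert.prems(2)) simp
    finally show "(\<Sum>C | C \<in> \<F> \<and> C \<noteq> B \<and> B \<inter> C \<noteq> {}. q ^ card (C - B)) \<le> 1 / 2" .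
  qed (use insert.prems in auto)
  have "A \<subseteq> S \<and> none J0 S \<longleftrightarrow> A \<subseteq> S \<and> none \<F> S \<or> (\<exists>B\<in>J1. A \<subseteq> S \<and> B \<subseteq> S \<and> none J0 S)" for S
    by (auto simp: none_def J0_def J1_def)
  then have "?p (\<lambda>S. A \<subseteq> S \<and> none J0 S)
      \<le> ?p (\<lambda>S. A \<subseteq> S \<and> none \<F> S) + ?p (\<lambda>S. \<exists>B\<in>J1. A \<subseteq> S \<and> B \<subseteq> S \<and> none J0 S)"
    using subset_prob_disj by simp
  moreover have "?p (\<lambda>S. A \<subseteq> S \<and> none J0 S) = q ^ card A * ?p (none J0)"
  proof -
    have ind: "none J0 (S \<union> T) = none J0 S" if "T \<subseteq> A" for S T
      using that by (auto simp: none_def J0_def) blast+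
    have "none J0 (S \<union> A) = none J0 S" for S
      using ind[of A S] by simp
    moreover have "subset_prob (E - A \<union> A) q (none J0) = subset_prob (E - A) q (none J0)"
      using assms(1) fin ind by (intro subset_prob_irrelevant) auto
    ultimately show ?thesis
      using assms(1) AE by (subst subset_prob_superset) (auto simp: Un_absorb2)
  qed
  moreover have "?p (\<lambda>S. \<exists>B\<in>J1. A \<subseteq> S \<and> B \<subseteq> S \<and> none J0 S) \<le> q ^ card A / 2 * ?p (none J0)"
  proof -
    have "?p (\<lambda>S. \<exists>B\<in>J1. A \<subseteq> S \<and> B \<subseteq> S \<and> none J0 S)
      \<le> (\<Sum>B\<in>J1. ?p (\<lambda>S. A \<subseteq> S \<and> B \<subseteq> S \<and> none J0 S))"
      using fin by (intro subset_prob_Bex)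
    also have "\<dots> \<le> (\<Sum>B\<in>J1. q ^ card A * q ^ card (B - A) * ?p (none J0))"
    proof (rule sum_mono)
      fix B assume "B \<in> J1"
      then have BE: "B \<subseteq> E" using insert.prems(1) by (auto simp: J1_def)
      then have B: "B \<subseteq> E" "finite B" using assms(1) finite_subset by auto
      have "A \<union> B = A \<union> (B - A)" by auto
      then have "card (A \<union> B) = card A + card (B - A)"
        using fin B by (metis card_Un_disjoint finite_Diff Diff_disjoint)
      moreover have "?p (\<lambda>S. A \<union> B \<subseteq> S \<and> none J0 S) \<le> q ^ card (A \<union> B) * ?p (none J0)"
        using B AE assms(1) by (intro subset_prob_superset_antimono) (auto intro: anti)
      ultimately show "?p (\<lambda>S. A \<subseteq> S \<and> B \<subseteq> S \<and> none J0 S)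
          \<le> q ^ card A * q ^ card (B - A) * ?p (none J0)"
        by (simp add: power_add conj_assoc)
    qed
    also have "\<dots> = (\<Sum>B\<in>J1. q ^ card (B - A)) * (q ^ card A * ?p (none J0))"
      by (simp add: sum_distrib_left sum_distrib_right mult_ac)
    also have "\<dots> \<le> 1 / 2 * (q ^ card A * ?p (none J0))"
    proof (rule mult_right_mono)
      show "(\<Sum>B\<in>J1. q ^ card (B - A)) \<le> 1 / 2"
        unfolding J by (rule insert.prems(2)) simp
      show "0 \<le> q ^ card A * ?p (none J0)"
        by (intro mult_nonneg_nonneg zero_le_power q0 subset_prob_nonneg)
    qed
    finally show ?thesis by simp
  qed
  ultimately have "q ^ card A / 2 * ?p (none J0) \<le> ?p (\<lambda>S. A \<subseteq> S \<and> none \<F> S)"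
    by (simp add: algebra_simps)
  moreover have "?p (none \<F>) \<le> ?p (none J0)"
    using assms(1) by (intro subset_prob_mono) (auto simp: none_def J0_def)
  then have "q ^ card A / 2 * ?p (none \<F>) \<le> q ^ card A / 2 * ?p (none J0)"
    using q0 by (intro mult_left_mono) auto
  moreover have "?p (none \<F>) = ?p (\<lambda>S. A \<subseteq> S \<and> none \<F> S) + ?p (none (insert A \<F>))"
    unfolding subset_prob_def sum.distrib[symmetric]
    by (intro sum.cong) (auto simp: none_def)
  ultimately have "?p (none (insert A \<F>)) \<le> (1 - q ^ card A / 2) * ?p (none \<F>)"
    by (simp add: algebra_simps)
  also have "\<dots> \<le> (1 - q ^ card A / 2) * (\<Prod>A\<in>\<F>. 1 - q ^ card A / 2)"
  proof (intro mult_left_mono IH)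
    have "q ^ card A \<le> 1" using q0 q1 by (simp add: power_le_one)
    then show "0 \<le> 1 - q ^ card A / 2" by simp
  qed
  finally show ?case using insert.hyps by (simp add: none_def[abs_def])
qed

lemma subset_prob_card_ge:
  assumes "finite E" "F \<subseteq> E"
  shows "subset_prob E q (\<lambda>S. k \<le> card (S \<inter> F)) \<le> real (card F choose k) * q ^ k"
proof -
  have finF: "finite F" using assms finite_subset by blast
  let ?I = "{K. K \<subseteq> F \<and> card K = k}"
  have "subset_prob E q (\<lambda>S. k \<le> card (S \<inter> F)) \<le> subset_prob E q (\<lambda>S. \<exists>K\<in>?I. K \<subseteq> S)"
  proof (intro subset_prob_mono assms)
    fix S assume "k \<le> card (S \<inter> F)"
    then obtain K where "K \<subseteq> S \<inter> F" "card K = k"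
      by (meson obtain_subset_with_card_n)
    then show "\<exists>K\<in>?I. K \<subseteq> S" by auto
  qed
  also have "\<dots> \<le> (\<Sum>K\<in>?I. subset_prob E q (\<lambda>S. K \<subseteq> S))"
    using finF by (intro subset_prob_Bex) auto
  also have "\<dots> = (\<Sum>K\<in>?I. q ^ k)"
  proof (rule sum.cong)
    fix K assume K: "K \<in> ?I"
    then have "subset_prob E q (\<lambda>S. K \<subseteq> S \<and> True) = q ^ card K * subset_prob (E - K) q (\<lambda>_. True)"
      using assms by (intro subset_prob_superset) auto
    then show "subset_prob E q (\<lambda>S. K \<subseteq> S) = q ^ k"
      using K assms by (simp add: subset_prob_True)
  qed simp
  finally show ?thesis using finF by (simp add: n_subsets)
qed

end

section \<open>Trees spanned by pairs\<close>

text \<open>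
  Position \<open>i\<close> of a tree carries two vertices, one on a path and one leaf, and \<open>\<phi> i\<close> is the position
  to whose path vertex the leaf of position \<open>i\<close> is attached.  Leaves are attached across
  the middle \<open>p div 2\<close> of the path, and the two leaves next to the middle are attached to the ends of
  the path.  This is what makes \<open>no_small_subtree\<close> true, and it fixes only two of the \<open>p\<close> values.
\<close>

definition attachments :: "nat \<Rightarrow> (nat \<Rightarrow> nat) set" where
  "attachments p = (\<Pi>\<^sub>E i\<in>{..<p}.
     if Suc i = p div 2 then {p - 1} else if i = p div 2 then {0}
     else if i < p div 2 then {p div 2..<p} else {..<p div 2})"

definition placements :: "nat \<Rightarrow> nat \<Rightarrow> (nat \<Rightarrow> nat) set" where
  "placements p m = {\<sigma> \<in> {..<p} \<rightarrow>\<^sub>E {..<m}. inj_on \<sigma> {..<p}}"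

text \<open>
  The edges of the tree on the pairs \<open>(a (\<sigma> i), b (\<sigma> i))\<close>, \<open>i < p\<close>.  They are ordered pairs, and the
  random set will be a set of ordered pairs too: the direction of the path then determines \<open>\<sigma>\<close>,
  whereas an undirected path could also be traversed backwards.
\<close>

definition tree_arcs ::
  "nat \<Rightarrow> (nat \<Rightarrow> 'a) \<Rightarrow> (nat \<Rightarrow> 'a) \<Rightarrow> (nat \<Rightarrow> nat) \<Rightarrow> (nat \<Rightarrow> nat) \<Rightarrow> ('a \<times> 'a) set" where
  "tree_arcs p a b \<sigma> \<phi> =
     (\<lambda>i. (a (\<sigma> i), a (\<sigma> (Suc i)))) ` {..<p - 1} \<union> (\<lambda>i. (b (\<sigma> i), a (\<sigma> (\<phi> i)))) ` {..<p}"

lemma finite_attachments: "finite (attachments p)"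
  unfolding attachments_def by (intro finite_PiE) auto

lemma finite_placements: "finite (placements p m)"
  unfolding placements_def by (rule finite_subset[of _ "{..<p} \<rightarrow>\<^sub>E {..<m}"]) (auto intro: finite_PiE)

lemma attachments_mem:
  assumes "\<phi> \<in> attachments p" "i < p"
  shows "\<phi> i \<in> (if Suc i = p div 2 then {p - 1} else if i = p div 2 then {0}
     else if i < p div 2 then {p div 2..<p} else {..<p div 2})"
  using assms(1) unfolding attachments_def by (rule PiE_mem) (use assms(2) in simp)

lemma attachments_less:
  assumes "2 \<le> p" "\<phi> \<in> attachments p" "i < p"
  shows "\<phi> i < p"
  using attachments_mem[OF assms(2,3)] assms(1) by (simp split: if_splits)

lemma attachments_crossing:
  assumes "2 \<le> p" "\<phi> \<in> attachments p"
  shows "i < p div 2 \<Longrightarrow> p div 2 \<le> \<phi> i" "p div 2 \<le> i \<Longrightarrow> i < p \<Longrightarrow> \<phi> i < p div 2"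
    "\<phi> (p div 2 - 1) = p - 1" "\<phi> (p div 2) = 0"
proof -
  have h: "0 < p div 2" "p div 2 < p" using assms(1) by auto
  note mem = attachments_mem[OF assms(2)]
  show "i < p div 2 \<Longrightarrow> p div 2 \<le> \<phi> i" using mem[of i] h by (simp split: if_splits)
  show "p div 2 \<le> i \<Longrightarrow> i < p \<Longrightarrow> \<phi> i < p div 2" using mem[of i] h by (simp split: if_splits)
  show "\<phi> (p div 2 - 1) = p - 1" using mem[of "p div 2 - 1"] h by simp
  show "\<phi> (p div 2) = 0" using mem[of "p div 2"] h by simp
qed

text \<open>
  A set \<open>K\<close> of positions spans a forest on \<open>2 * card K\<close> vertices, which has at most
  \<open>2 * card K - 2\<close> edges unless it is a tree.  If it is a tree, \<open>K\<close> is an interval closed under \<open>\<phi>\<close>.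
  As \<open>\<phi>\<close> crosses the middle, \<open>K\<close> contains both positions next to the middle, whose images are the
  two ends of the path; so \<open>K\<close> is everything.
\<close>

lemma no_small_subtree:
  assumes p: "2 \<le> p" and \<phi>: "\<phi> \<in> attachments p"
    and K: "K \<subseteq> {..<p}" "K \<noteq> {}" "K \<noteq> {..<p}"
  shows "card {i \<in> K. Suc i \<in> K} + card {i \<in> K. \<phi> i \<in> K} + 2 \<le> 2 * card K"
proof (rule ccontr)
  assume neg: "\<not> ?thesis"
  have fin: "finite K" using K(1) finite_subset by blast
  define r where "r = Max K"
  have r: "r \<in> K" "\<And>i. i \<in> K \<Longrightarrow> i \<le> r"
    using fin K(2) by (auto simp: r_def)
  then have sub: "{i \<in> K. Suc i \<in> K} \<subseteq> K - {r}" by fastforce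
  then have "card {i \<in> K. Suc i \<in> K} \<le> card K - 1"
    using fin r(1) by (metis card_Diff_singleton card_mono finite_Diff)
  moreover have "card {i \<in> K. \<phi> i \<in> K} \<le> card K" using fin by (intro card_mono) auto
  moreover have "card K \<ge> 1" using K(2) fin by (simp add: Suc_leI card_gt_0_iff)
  ultimately have "card {i \<in> K. Suc i \<in> K} = card (K - {r})" "card {i \<in> K. \<phi> i \<in> K} = card K"
    using neg r(1) by auto
  then have "{i \<in> K. Suc i \<in> K} = K - {r}" "{i \<in> K. \<phi> i \<in> K} = K"
    using sub fin card_subset_eq[of "K - {r}"] card_subset_eq[of K "{i \<in> K. \<phi> i \<in> K}"] by auto
  then have succ: "\<And>i. i \<in> K \<Longrightarrow> i \<noteq> r \<Longrightarrow> Suc i \<in> K" and closed: "\<And>i. i \<in> K \<Longrightarrow> \<phi> i \<in> K"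
    by blast+
  have up: "j \<in> K" if "i \<in> K" "i \<le> j" "j \<le> r" for i j
    using that(2,3)
  proof (induction j rule: dec_induct)
    case base
    show ?case by fact
  next
    case (step n)
    then show ?case using succ[of n] by auto
  qed
  let ?h = "p div 2"
  have h: "0 < ?h" "?h < p" using p by auto
  have "\<exists>x\<in>K. x < ?h"
    using K(1,2) closed attachments_crossing(2)[OF p \<phi>] by (meson ex_in_conv lessThan_iff not_le subsetD)
  then obtain x where x: "x \<in> K" "x < ?h" by blast
  then have "?h \<le> r"
    using closed attachments_crossing(1)[OF p \<phi>] r(2) by (meson order_trans)
  then have mid: "?h - 1 \<in> K" "?h \<in> K"
    using up[OF x(1)] x(2) h by auto
  then have "p - 1 \<in> K" "0 \<in> K"
    using closed attachments_crossing(3,4)[OF p \<phi>] by metis+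
  then have "{..<p} \<subseteq> K" using up[of 0] r(2) by force
  then show False using K by auto
qed

lemma card_attachments:
  assumes "2 \<le> p"
  shows "(p div 2) ^ (p - 2) \<le> card (attachments p)" "card (attachments p) \<le> p ^ p"
proof -
  let ?h = "p div 2"
  let ?T = "\<lambda>i. if Suc i = ?h then {p - 1} else if i = ?h then {0}
     else if i < ?h then {?h..<p} else {..<?h}"
  have h: "0 < ?h" "?h < p" using assms by auto
  have "(\<Prod>i<p. if i \<in> {?h - 1, ?h} then 1 else ?h) = (\<Prod>i\<in>{..<p} - {?h - 1, ?h}. ?h)"
    by (rule prod.mono_neutral_cong_right) auto
  also have "\<dots> = ?h ^ (p - 2)"
    using h by (simp add: card_Diff_subset numeral_2_eq_2)
  finally have "?h ^ (p - 2) = (\<Prod>i<p. if i \<in> {?h - 1, ?h} then 1 else ?h)" by simp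
  also have "\<dots> \<le> (\<Prod>i<p. card (?T i))"
    by (intro prod_mono) auto
  also have "\<dots> = card (attachments p)"
    unfolding attachments_def by (subst card_PiE) auto
  finally show "?h ^ (p - 2) \<le> card (attachments p)" .
  have "card (attachments p) \<le> card ({..<p} \<rightarrow>\<^sub>E {..<p})"
    using attachments_less[OF assms]
    by (intro card_mono finite_PiE) (auto simp: PiE_iff attachments_def)
  then show "card (attachments p) \<le> p ^ p" by (simp add: card_funcsetE)
qed

lemma card_placements:
  assumes "2 * p \<le> m"
  shows "(real m / 2) ^ p \<le> real (card (placements p m))"
proof -
  have "card (placements p m) = (\<Prod>i<p. m - i)"
    unfolding placements_def
    using card_inj_on_subset_funcset[of "{..<p}" "{..<m}" "{..<p}"]
    by (simp add: atLeast0LessThan)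
  moreover have "(\<Prod>i<p. real m / 2) \<le> (\<Prod>i<p. real (m - i))"
    using assms by (intro prod_mono) (auto simp: of_nat_diff)
  ultimately show ?thesis by simp
qed

section \<open>The family of trees on given disjoint pairs\<close>

locale pairing =
  fixes m p :: nat and a b :: "nat \<Rightarrow> 'a"
  assumes inj_a: "inj_on a {..<m}" and inj_b: "inj_on b {..<m}"
    and disjoint: "a ` {..<m} \<inter> b ` {..<m} = {}" and p2: "2 \<le> p"
begin

lemma a_eq_iff: "i < m \<Longrightarrow> j < m \<Longrightarrow> a i = a j \<longleftrightarrow> i = j"
  and b_eq_iff: "i < m \<Longrightarrow> j < m \<Longrightarrow> b i = b j \<longleftrightarrow> i = j"
  and a_neq_b: "i < m \<Longrightarrow> j < m \<Longrightarrow> a i \<noteq> b j"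
  using inj_a inj_b disjoint by (auto simp: inj_on_eq_iff)

lemma placement_less: "\<sigma> \<in> placements p m \<Longrightarrow> i < p \<Longrightarrow> \<sigma> i < m"
  and placement_eq_iff: "\<sigma> \<in> placements p m \<Longrightarrow> i < p \<Longrightarrow> j < p \<Longrightarrow> \<sigma> i = \<sigma> j \<longleftrightarrow> i = j"
  by (auto simp: placements_def PiE_iff inj_on_eq_iff)

lemma card_tree_arcs:
  assumes "\<sigma> \<in> placements p m" "\<phi> \<in> attachments p"
  shows "card (tree_arcs p a b \<sigma> \<phi>) = 2 * p - 1"
proof -
  note less = attachments_less[OF p2 assms(2)]
  note simps = placement_less[OF assms(1)] placement_eq_iff[OF assms(1)] a_eq_iff b_eq_iff a_neq_b less
  have "inj_on (\<lambda>i. (a (\<sigma> i), a (\<sigma> (Suc i)))) {..<p - 1}"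
    by (auto simp: inj_on_def simps)
  moreover have "inj_on (\<lambda>i. (b (\<sigma> i), a (\<sigma> (\<phi> i)))) {..<p}"
    by (auto simp: inj_on_def simps)
  moreover have "(\<lambda>i. (a (\<sigma> i), a (\<sigma> (Suc i)))) ` {..<p - 1}
      \<inter> (\<lambda>i. (b (\<sigma> i), a (\<sigma> (\<phi> i)))) ` {..<p} = {}"
    by (auto simp: simps)
  ultimately show ?thesis
    unfolding tree_arcs_def using p2 by (simp add: card_Un_disjoint card_image)
qed

text \<open>
  An edge lying in two trees joins vertices of pairs that both trees use.  Here \<open>K\<close> is the set
  of positions of the second tree at which it uses a pair of the first.
\<close>

lemma tree_arcs_inter:
  assumes \<sigma>: "\<sigma> \<in> placements p m" and \<phi>: "\<phi> \<in> attachments p"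
    and \<tau>: "\<tau> \<in> placements p m" and \<psi>: "\<psi> \<in> attachments p"
    and K: "K = {i. i < p \<and> \<tau> i \<in> \<sigma> ` {..<p}}"
  shows "tree_arcs p a b \<sigma> \<phi> \<inter> tree_arcs p a b \<tau> \<psi> \<subseteq>
    (\<lambda>i. (a (\<tau> i), a (\<tau> (Suc i)))) ` {i \<in> K. Suc i \<in> K} \<union>
    (\<lambda>i. (b (\<tau> i), a (\<tau> (\<psi> i)))) ` {i \<in> K. \<psi> i \<in> K}"
proof
  note simps = placement_less[OF \<sigma>] placement_less[OF \<tau>] a_eq_iff b_eq_iff a_neq_b
    a_neq_b[symmetric] attachments_less[OF p2 \<phi>] attachments_less[OF p2 \<psi>]
  fix e assume e: "e \<in> tree_arcs p a b \<sigma> \<phi> \<inter> tree_arcs p a b \<tau> \<psi>"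
  then consider i where "i < p - 1" "e = (a (\<tau> i), a (\<tau> (Suc i)))"
    | i where "i < p" "e = (b (\<tau> i), a (\<tau> (\<psi> i)))"
    by (auto simp: tree_arcs_def)
  then show "e \<in> (\<lambda>i. (a (\<tau> i), a (\<tau> (Suc i)))) ` {i \<in> K. Suc i \<in> K} \<union>
    (\<lambda>i. (b (\<tau> i), a (\<tau> (\<psi> i)))) ` {i \<in> K. \<psi> i \<in> K}"
  proof cases
    case 1
    then obtain j where "j < p - 1" "e = (a (\<sigma> j), a (\<sigma> (Suc j)))"
      using e by (auto simp: tree_arcs_def simps)
    then have "i \<in> K" "Suc i \<in> K"
      using 1 by (auto simp: K simps)
    then show ?thesis using 1 by blast
  next
    case 2
    then obtain j where "j < p" "e = (b (\<sigma> j), a (\<sigma> (\<phi> j)))"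
      using e by (auto simp: tree_arcs_def simps)
    then have "i \<in> K" "\<psi> i \<in> K"
      using 2 by (auto simp: K simps)
    then show ?thesis using 2 by blast
  qed
qed

lemma tree_arcs_inject:
  assumes \<sigma>: "\<sigma> \<in> placements p m" and \<phi>: "\<phi> \<in> attachments p"
    and \<tau>: "\<tau> \<in> placements p m" and \<psi>: "\<psi> \<in> attachments p"
    and eq: "tree_arcs p a b \<sigma> \<phi> = tree_arcs p a b \<tau> \<psi>"
  shows "\<sigma> = \<tau> \<and> \<phi> = \<psi>"
proof -
  note simps = placement_less[OF \<sigma>] placement_less[OF \<tau>] a_eq_iff b_eq_iff a_neq_b
    a_neq_b[symmetric] attachments_less[OF p2 \<phi>] attachments_less[OF p2 \<psi>]
    placement_eq_iff[OF \<sigma>] placement_eq_iff[OF \<tau>]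
  \<comment> \<open>The two directed paths have the same edges, so they start at the same vertex, the one without
    predecessor, and then agree step by step.\<close>
  have path: "\<exists>j<p - 1. \<sigma> j = \<tau> i \<and> \<sigma> (Suc j) = \<tau> (Suc i)" if "i < p - 1" for i
  proof -
    have "(a (\<tau> i), a (\<tau> (Suc i))) \<in> tree_arcs p a b \<sigma> \<phi>"
      unfolding eq using that by (auto simp: tree_arcs_def)
    then show ?thesis using that by (auto simp: tree_arcs_def simps)
  qed
  have path': "\<exists>j<p - 1. \<tau> j = \<sigma> i \<and> \<tau> (Suc j) = \<sigma> (Suc i)" if "i < p - 1" for i
  proof -
    have "(a (\<sigma> i), a (\<sigma> (Suc i))) \<in> tree_arcs p a b \<tau> \<psi>"
      unfolding eq[symmetric] using that by (auto simp: tree_arcs_def)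
    then show ?thesis using that by (auto simp: tree_arcs_def simps)
  qed
  have same: "\<sigma> i = \<tau> i" if "i < p" for i
    using that
  proof (induction i)
    case 0
    obtain j where j: "j < p - 1" "\<sigma> j = \<tau> 0" using path[of 0] p2 by auto
    have "j = 0"
    proof (rule ccontr)
      assume "j \<noteq> 0"
      then obtain k where k: "j = Suc k" by (cases j) auto
      then obtain l where "l < p - 1" "\<tau> (Suc l) = \<tau> 0" using path'[of k] j by auto
      then show False using p2 by (auto simp: simps)
    qed
    then show ?case using j by simp
  next
    case (Suc i)
    then have "i < p - 1" by simp
    with Suc obtain j where "j < p - 1" "\<sigma> j = \<tau> i" "\<sigma> (Suc j) = \<tau> (Suc i)" using path[of i] by auto
    moreover from this have "j = i"
      using Suc placement_eq_iff[OF \<sigma>, of j i] by simp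
    ultimately show ?case by simp
  qed
  then have "\<sigma> = \<tau>" using \<sigma> \<tau> by (auto simp: placements_def intro: PiE_ext)
  moreover have "\<phi> i = \<psi> i" if i: "i < p" for i
  proof -
    have "(b (\<sigma> i), a (\<sigma> (\<phi> i))) \<in> tree_arcs p a b \<tau> \<psi>"
      unfolding eq[symmetric] using i by (auto simp: tree_arcs_def)
    then obtain j where "j < p" "b (\<sigma> i) = b (\<tau> j)" "a (\<sigma> (\<phi> i)) = a (\<tau> (\<psi> j))"
      using i by (auto simp: tree_arcs_def simps)
    then show ?thesis using i \<open>\<sigma> = \<tau>\<close> by (auto simp: simps)
  qed
  then have "\<phi> = \<psi>" using \<phi> \<psi> by (auto simp: attachments_def intro: PiE_ext)
  ultimately show ?thesis by simp
qed

definition tree_family :: "('a \<times> 'a) set set" where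
  "tree_family = (\<lambda>(\<sigma>, \<phi>). tree_arcs p a b \<sigma> \<phi>) ` (placements p m \<times> attachments p)"

lemma inj_on_tree_arcs: "inj_on (\<lambda>(\<sigma>, \<phi>). tree_arcs p a b \<sigma> \<phi>) (placements p m \<times> attachments p)"
  using tree_arcs_inject by (auto simp: inj_on_def)

lemma card_tree_family: "card tree_family = card (placements p m) * card (attachments p)"
  unfolding tree_family_def using inj_on_tree_arcs by (simp add: card_image card_cartesian_product)

text \<open>
  Two new edges for each pair that is not shared would not be enough; \<open>no_small_subtree\<close> gives one
  edge more.  This bounds the overlaps: each of the \<open>p - card K\<close> new pairs brings \<open>m\<close> choices against
  a factor \<open>q ^ 2\<close>, the product \<open>m * q ^ 2\<close> exceeds 1, and the factor \<open>q\<close> left over compensates for it.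
\<close>

lemma tree_arcs_diff:
  assumes \<sigma>: "\<sigma> \<in> placements p m" and \<phi>: "\<phi> \<in> attachments p"
    and \<tau>: "\<tau> \<in> placements p m" and \<psi>: "\<psi> \<in> attachments p"
    and K: "K = {i. i < p \<and> \<tau> i \<in> \<sigma> ` {..<p}}"
    and neq: "tree_arcs p a b \<tau> \<psi> \<noteq> tree_arcs p a b \<sigma> \<phi>"
    and meet: "tree_arcs p a b \<sigma> \<phi> \<inter> tree_arcs p a b \<tau> \<psi> \<noteq> {}"
  shows "2 \<le> card K" "2 * (p - card K) + 1 \<le> card (tree_arcs p a b \<tau> \<psi> - tree_arcs p a b \<sigma> \<phi>)"
proof -
  let ?A = "tree_arcs p a b \<sigma> \<phi>" and ?B = "tree_arcs p a b \<tau> \<psi>"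
  have fin: "finite K" "finite ?A" "finite ?B" by (auto simp: K tree_arcs_def)
  have "card (?A \<inter> ?B) \<le> card ((\<lambda>i. (a (\<tau> i), a (\<tau> (Suc i)))) ` {i \<in> K. Suc i \<in> K} \<union>
    (\<lambda>i. (b (\<tau> i), a (\<tau> (\<psi> i)))) ` {i \<in> K. \<psi> i \<in> K})"
    using fin by (intro card_mono tree_arcs_inter[OF \<sigma> \<phi> \<tau> \<psi> K]) auto
  also have "\<dots> \<le> card {i \<in> K. Suc i \<in> K} + card {i \<in> K. \<psi> i \<in> K}"
    using fin by (intro order.trans[OF card_Un_le] add_mono card_image_le) auto
  finally have le: "card (?A \<inter> ?B) \<le> card {i \<in> K. Suc i \<in> K} + card {i \<in> K. \<psi> i \<in> K}" .
  have pos: "0 < card (?A \<inter> ?B)" using meet fin by (simp add: card_gt_0_iff)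
  have K0: "K \<noteq> {}"
    using le pos by auto
  have Kp: "K \<subseteq> {..<p}" by (auto simp: K)
  have bound: "card (?A \<inter> ?B) + 2 \<le> 2 * card K"
  proof (cases "K = {..<p}")
    case True
    have "?A \<inter> ?B \<noteq> ?B"
    proof
      assume "?A \<inter> ?B = ?B"
      then have "?B \<subseteq> ?A" by blast
      then have "?B = ?A"
        using fin card_tree_arcs[OF \<sigma> \<phi>] card_tree_arcs[OF \<tau> \<psi>] by (intro card_subset_eq) auto
      then show False using neq by simp
    qed
    then have "card (?A \<inter> ?B) < card ?B" using fin by (intro psubset_card_mono) auto
    then show ?thesis using card_tree_arcs[OF \<tau> \<psi>] True by simp
  next
    case False
    then show ?thesis using no_small_subtree[OF p2 \<psi> Kp K0 False] le by simp
  qed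
  then show "2 \<le> card K" using pos by simp
  have "card (?B - ?A) = card ?B - card (?A \<inter> ?B)"
    using fin by (metis card_Diff_subset_Int finite_Int inf_commute)
  moreover have "card K \<le> p" using card_mono[OF _ Kp] by simp
  ultimately show "2 * (p - card K) + 1 \<le> card (?B - ?A)"
    using bound card_tree_arcs[OF \<tau> \<psi>] by linarith
qed

text \<open>
  The trees meeting \<open>A\<close> are sorted by the set \<open>L\<close> of positions at which they use pairs of \<open>A\<close>.
  There are at most \<open>2 ^ p\<close> such sets, and for each of them at most \<open>p ^ card L * m ^ (p - card L)\<close> placements
  and \<open>p ^ p\<close> attachments.  As \<open>m * q ^ 2\<close> is at least 1 and \<open>card L\<close> at least 2, the worst case is
  \<open>card L = 2\<close>.
\<close>

lemma overlap_sum: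
  assumes q: "0 \<le> q" "q \<le> 1" and mq: "1 \<le> real m * q\<^sup>2" and A: "A \<in> tree_family"
  shows "(\<Sum>B | B \<in> tree_family \<and> B \<noteq> A \<and> A \<inter> B \<noteq> {}. q ^ card (B - A))
    \<le> (2 * real p ^ 2) ^ p * q * (real m * q\<^sup>2) ^ (p - 2)"
proof -
  obtain \<sigma> \<phi> where \<sigma>: "\<sigma> \<in> placements p m" and \<phi>: "\<phi> \<in> attachments p"
    and A: "A = tree_arcs p a b \<sigma> \<phi>"
    using A by (auto simp: tree_family_def)
  let ?T = "\<lambda>(\<tau>, \<psi>). tree_arcs p a b \<tau> \<psi>"
  let ?I = "placements p m \<times> attachments p"
  define K where "K = (\<lambda>x :: (nat \<Rightarrow> nat) \<times> (nat \<Rightarrow> nat). {i. i < p \<and> fst x i \<in> \<sigma> ` {..<p}})"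
  define J where "J = {x \<in> ?I. ?T x \<noteq> A \<and> A \<inter> ?T x \<noteq> {}}"
  define \<K> where "\<K> = {L. L \<subseteq> {..<p} \<and> 2 \<le> card L}"
  have fin: "finite J" "finite \<K>"
    using finite_attachments finite_placements by (auto simp: J_def \<K>_def)
  have J: "card (K x) \<ge> 2" "2 * (p - card (K x)) + 1 \<le> card (?T x - A)" if "x \<in> J" for x
    using that tree_arcs_diff[OF \<sigma> \<phi>, of "fst x" "snd x" "K x"]
    by (auto simp: J_def A K_def split: prod.splits)
  have "{B. B \<in> tree_family \<and> B \<noteq> A \<and> A \<inter> B \<noteq> {}} = ?T ` J"
    by (auto simp: tree_family_def J_def)
  moreover have "inj_on ?T J"
    using inj_on_tree_arcs by (rule inj_on_subset) (auto simp: J_def)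
  ultimately have "(\<Sum>B | B \<in> tree_family \<and> B \<noteq> A \<and> A \<inter> B \<noteq> {}. q ^ card (B - A))
    = (\<Sum>x\<in>J. q ^ card (?T x - A))"
    by (simp add: sum.reindex)
  also have "\<dots> \<le> (\<Sum>x\<in>J. q ^ (2 * (p - card (K x)) + 1))"
    using J q by (intro sum_mono power_decreasing) auto
  also have "\<dots> = (\<Sum>L\<in>\<K>. \<Sum>x | x \<in> J \<and> K x = L. q ^ (2 * (p - card (K x)) + 1))"
    using fin J(1) by (intro sum.group[symmetric]) (auto simp: \<K>_def K_def)
  also have "\<dots> \<le> (\<Sum>L\<in>\<K>. real p ^ p * real p ^ p * q * (real m * q\<^sup>2) ^ (p - 2))"
  proof (rule sum_mono)
    fix L assume "L \<in> \<K>"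
    then have L: "L \<subseteq> {..<p}" "2 \<le> card L" by (auto simp: \<K>_def)
    have Lp: "card L \<le> p" using card_mono[OF _ L(1)] by simp
    have "{x \<in> J. K x = L} \<subseteq>
      ((\<Pi>\<^sub>E i\<in>{..<p}. if i \<in> L then \<sigma> ` {..<p} else {..<m}) \<times> attachments p)"
    proof
      fix x assume x: "x \<in> {x \<in> J. K x = L}"
      then have "fst x \<in> placements p m" "snd x \<in> attachments p"
        by (auto simp: J_def)
      moreover from this(1) have "fst x \<in> (\<Pi>\<^sub>E i\<in>{..<p}. if i \<in> L then \<sigma> ` {..<p} else {..<m})"
        using x by (auto simp: K_def placements_def PiE_iff)
      ultimately show "x \<in> (\<Pi>\<^sub>E i\<in>{..<p}. if i \<in> L then \<sigma> ` {..<p} else {..<m}) \<times> attachments p"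
        by (simp add: mem_Times_iff)
    qed
    then have "card {x \<in> J. K x = L} \<le>
      card ((\<Pi>\<^sub>E i\<in>{..<p}. if i \<in> L then \<sigma> ` {..<p} else {..<m}) \<times> attachments p)"
      using finite_attachments by (intro card_mono finite_cartesian_product finite_PiE) auto
    also have "\<dots> = (\<Prod>i<p. if i \<in> L then card (\<sigma> ` {..<p}) else m) * card (attachments p)"
      by (simp add: card_cartesian_product card_PiE if_distrib cong: if_cong)
    also have "(\<Prod>i<p. if i \<in> L then card (\<sigma> ` {..<p}) else m)
      = card (\<sigma> ` {..<p}) ^ card L * m ^ (p - card L)"
    proof -
      have "{..<p} \<inter> {i. i \<in> L} = L" "{..<p} \<inter> - {i. i \<in> L} = {..<p} - L"
        using L(1) by auto
      moreover have "card ({..<p} - L) = p - card L"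
        using L(1) by (simp add: card_Diff_subset finite_subset[OF L(1)])
      ultimately show ?thesis by (simp add: prod.If_cases)
    qed
    also have "card (\<sigma> ` {..<p}) = p"
      using \<sigma> by (simp add: card_image placements_def)
    also have "p ^ card L * m ^ (p - card L) * card (attachments p)
      \<le> p ^ p * m ^ (p - card L) * p ^ p"
      using card_attachments(2)[OF p2] Lp p2
      by (intro mult_le_mono power_increasing[of "card L" p p] le_refl) auto
    finally have "card {x \<in> J. K x = L} \<le> p ^ p * m ^ (p - card L) * p ^ p" .
    then have c: "real (card {x \<in> J. K x = L}) \<le> real p ^ p * real m ^ (p - card L) * real p ^ p"
      by (simp only: of_nat_le_iff flip: of_nat_power of_nat_mult)
    have "(\<Sum>x | x \<in> J \<and> K x = L. q ^ (2 * (p - card (K x)) + 1))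
      = real (card {x \<in> J. K x = L}) * q ^ (2 * (p - card L) + 1)" by simp
    also have "\<dots> \<le> real p ^ p * real m ^ (p - card L) * real p ^ p * q ^ (2 * (p - card L) + 1)"
      using c q by (intro mult_right_mono) auto
    also have "\<dots> = real p ^ p * real p ^ p * q * (real m * q\<^sup>2) ^ (p - card L)"
    proof -
      have "q ^ (2 * (p - card L) + 1) = q * (q\<^sup>2) ^ (p - card L)"
        by (simp only: power_add power_mult power_one_right mult.commute)
      then show ?thesis by (simp only: power_mult_distrib mult_ac)
    qed
    also have "\<dots> \<le> real p ^ p * real p ^ p * q * (real m * q\<^sup>2) ^ (p - 2)"
      using mq q L(2) by (intro mult_left_mono power_increasing) auto
    finally show "(\<Sum>x | x \<in> J \<and> K x = L. q ^ (2 * (p - card (K x)) + 1))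
      \<le> real p ^ p * real p ^ p * q * (real m * q\<^sup>2) ^ (p - 2)" .
  qed
  also have "\<dots> = real (card \<K>) * (real p ^ p * real p ^ p * q * (real m * q\<^sup>2) ^ (p - 2))" by simp
  also have "\<dots> \<le> 2 ^ p * (real p ^ p * real p ^ p * q * (real m * q\<^sup>2) ^ (p - 2))"
  proof (intro mult_right_mono)
    have "card \<K> \<le> card (Pow {..<p})" by (intro card_mono) (auto simp: \<K>_def)
    then have "card \<K> \<le> 2 ^ p" by (simp add: card_Pow)
    then show "real (card \<K>) \<le> 2 ^ p" by (metis of_nat_le_iff of_nat_numeral of_nat_power)
  qed (use q in auto)
  also have "\<dots> = (2 * real p ^ 2) ^ p * q * (real m * q\<^sup>2) ^ (p - 2)"
    by (simp add: power_mult_distrib power2_eq_square mult_ac)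
  finally show ?thesis .
qed

lemma avoid_tree_family:
  assumes q: "0 \<le> q" "q \<le> 1" and mq: "1 \<le> real m * q\<^sup>2" and pm: "2 * p \<le> m"
    and sparse: "(2 * real p ^ 2) ^ p * q * (real m * q\<^sup>2) ^ (p - 2) \<le> 1 / 2"
    and E: "finite E" "a ` {..<m} \<union> b ` {..<m} \<subseteq> V" "E = V \<times> V"
  shows "subset_prob E q (\<lambda>S. \<forall>A\<in>tree_family. \<not> A \<subseteq> S)
    \<le> exp (- (q ^ (2 * p - 1) * (real m / 2) ^ p * real (p div 2) ^ (p - 2) / 2))"
proof -
  have sub: "A \<subseteq> E" "card A = 2 * p - 1" if mem: "A \<in> tree_family" for A
  proof -
    obtain \<sigma> \<phi> where \<sigma>: "\<sigma> \<in> placements p m" and \<phi>: "\<phi> \<in> attachments p"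
      and A: "A = tree_arcs p a b \<sigma> \<phi>"
      using mem by (auto simp: tree_family_def)
    show "card A = 2 * p - 1" using card_tree_arcs[OF \<sigma> \<phi>] A by simp
    have "a (\<sigma> i) \<in> V" "b (\<sigma> i) \<in> V" if "i < p" for i
      using placement_less[OF \<sigma> that] E(2) by auto
    then show "A \<subseteq> E" using attachments_less[OF p2 \<phi>] by (auto simp: A tree_arcs_def E(3))
  qed
  have fin: "finite tree_family"
    unfolding tree_family_def using finite_attachments finite_placements by auto
  have "subset_prob E q (\<lambda>S. \<forall>A\<in>tree_family. \<not> A \<subseteq> S) \<le> (\<Prod>A\<in>tree_family. 1 - q ^ card A / 2)"
    by (intro subset_prob_avoid_family q E fin sub order.trans[OF overlap_sum[OF q mq] sparse])
  also have "\<dots> = (1 - q ^ (2 * p - 1) / 2) ^ card tree_family"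
    using sub(2) by simp
  also have "\<dots> \<le> exp (- (q ^ (2 * p - 1) / 2)) ^ card tree_family"
  proof (rule power_mono)
    have "q ^ (2 * p - 1) \<le> 1" using q by (simp add: power_le_one)
    then show "0 \<le> 1 - q ^ (2 * p - 1) / 2" by simp
    show "1 - q ^ (2 * p - 1) / 2 \<le> exp (- (q ^ (2 * p - 1) / 2))"
      using exp_ge_add_one_self[of "- (q ^ (2 * p - 1) / 2)"] by simp
  qed
  also have "\<dots> = exp (- (q ^ (2 * p - 1) / 2 * real (card tree_family)))"
    by (simp add: exp_of_nat_mult[symmetric] mult_ac)
  also have "\<dots> \<le> exp (- (q ^ (2 * p - 1) / 2 * ((real m / 2) ^ p * real (p div 2) ^ (p - 2))))"
  proof -
    have "real (p div 2) ^ (p - 2) \<le> real (card (attachments p))"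
      using card_attachments(1)[OF p2] by (metis of_nat_le_iff of_nat_power)
    then have "(real m / 2) ^ p * real (p div 2) ^ (p - 2) \<le> real (card tree_family)"
      unfolding card_tree_family using card_placements[OF pm] by (auto intro!: mult_mono)
    then show ?thesis using q by (auto intro!: mult_left_mono)
  qed
  finally show ?thesis by (simp add: mult_ac)
qed

end

section \<open>From trees to obstructions for centered colorings\<close>

definition symmetric_graph :: "nat \<Rightarrow> (nat \<times> nat) set \<Rightarrow> nat pair_pre_digraph" where
  "symmetric_graph n S = \<lparr>pverts = {..<n},
     parcs = {(u, v). u < n \<and> v < n \<and> u \<noteq> v \<and> ((u, v) \<in> S \<or> (v, u) \<in> S)}\<rparr>"

lemma pair_graph_symmetric_graph: "pair_graph (symmetric_graph n S)"
proof -
  have "finite (parcs (symmetric_graph n S))"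
    by (rule finite_subset[of _ "{..<n} \<times> {..<n}"]) (auto simp: symmetric_graph_def)
  moreover have "sym (parcs (symmetric_graph n S))"
    by (auto simp: symmetric_graph_def sym_def)
  ultimately show ?thesis
    by unfold_locales (auto simp: symmetric_graph_def symmetric_def)
qed

lemma max_degree_symmetric_graph:
  assumes "\<And>v. v < n \<Longrightarrow> card (S \<inter> ({v} \<times> {..<n} \<union> {..<n} \<times> {v})) \<le> D"
  shows "max_degree (symmetric_graph n S) \<le> D"
proof -
  have "out_degree (with_proj (symmetric_graph n S)) v \<le> D" if v: "v < n" for v
  proof -
    let ?X = "S \<inter> ({v} \<times> {..<n} \<union> {..<n} \<times> {v})"
    have fin: "finite ?X" by auto
    have "out_arcs (with_proj (symmetric_graph n S)) v
      \<subseteq> (\<lambda>(x, y). if x = v then (x, y) else (y, x)) ` ?X"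
    proof
      fix e assume "e \<in> out_arcs (with_proj (symmetric_graph n S)) v"
      then obtain u where u: "e = (v, u)" "u < n" "u \<noteq> v" "(v, u) \<in> S \<or> (u, v) \<in> S"
        by (cases e) (auto simp: symmetric_graph_def)
      then show "e \<in> (\<lambda>(x, y). if x = v then (x, y) else (y, x)) ` ?X"
        by (force simp: image_iff)
    qed
    then have "card (out_arcs (with_proj (symmetric_graph n S)) v) \<le> card ?X"
      using fin by (meson surj_card_le)
    then show ?thesis unfolding out_degree_def using assms[OF v] by simp
  qed
  moreover have "pverts (symmetric_graph n S) = {..<n}" by (simp add: symmetric_graph_def)
  ultimately show ?thesis unfolding max_degree_def by auto
qed

lemma connected_induced_subgraph:
  assumes G: "pair_graph G" and W: "W \<subseteq> pverts G" and r: "r \<in> W"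
    and reach: "\<And>w. w \<in> W \<Longrightarrow> (r, w) \<in> (parcs G \<inter> W \<times> W)\<^sup>*"
  shows "connected_subgraph \<lparr>pverts = W, parcs = parcs G \<inter> W \<times> W\<rparr> G"
proof -
  interpret G: pair_graph G by (rule G)
  let ?H = "\<lparr>pverts = W, parcs = parcs G \<inter> W \<times> W\<rparr>"
  have symG: "sym (parcs G)" using G.pair_sym_arcs by (simp add: symmetric_def)
  then have sym: "sym (parcs G \<inter> W \<times> W)" by (auto simp: sym_def)
  have fin: "finite W" using W G.pair_finite_verts finite_subset by blast
  interpret H: pair_graph ?H
    using sym fin G.pair_finite_arcs G.pair_no_loops
    by unfold_locales (auto simp: symmetric_def)
  have "subgraph (with_proj ?H) (with_proj G)"
    using W H.wf_digraph_axioms G.wf_digraph_axioms by (auto simp: subgraph_def compatible_def)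
  moreover have "Digraph_Component.connected (with_proj ?H)"
    unfolding connected_def
  proof (rule strongly_connectedI)
    show "verts (with_proj (mk_symmetric (with_proj ?H))) \<noteq> {}" using r by auto
    fix u v assume "u \<in> verts (with_proj (mk_symmetric (with_proj ?H)))"
      "v \<in> verts (with_proj (mk_symmetric (with_proj ?H)))"
    then have uv: "u \<in> W" "v \<in> W" by auto
    have "(u, r) \<in> (parcs G \<inter> W \<times> W)\<^sup>*"
      using sym reach[OF uv(1)] by (meson sym_rtrancl symD)
    then have "(u, v) \<in> (parcs G \<inter> W \<times> W)\<^sup>*"
      using reach[OF uv(2)] by (rule rtrancl_trans)
    moreover have "W \<times> W \<inter> (parcs G \<inter> W \<times> W) = parcs G \<inter> W \<times> W" by auto
    ultimately have "u \<rightarrow>\<^sup>*\<^bsub>with_proj ?H\<^esub> v"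
      using uv H.reachable_conv by (simp add: Int_commute Int_left_commute)
    then show "u \<rightarrow>\<^sup>*\<^bsub>with_proj (mk_symmetric (with_proj ?H))\<^esub> v"
      by (rule H.reachable_mk_symmetricI)
  qed
  ultimately show ?thesis
    unfolding connected_subgraph_def using H.pair_graph_axioms by simp
qed

text \<open>Pairs are removed greedily: as long as more than \<open>c\<close> vertices remain, two of them have the same color.\<close>

lemma monochromatic_pairs:
  assumes "finite V" "card (f ` V) \<le> c" "c + 2 * k \<le> card V"
  shows "\<exists>a b :: nat \<Rightarrow> 'a. inj_on a {..<k} \<and> inj_on b {..<k} \<and> a ` {..<k} \<inter> b ` {..<k} = {} \<and>
    a ` {..<k} \<union> b ` {..<k} \<subseteq> V \<and> (\<forall>i<k. f (a i) = f (b i))"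
  using assms
proof (induction k arbitrary: V)
  case 0
  show ?case by auto
next
  case (Suc k)
  have "card (f ` V) < card V" using Suc.prems by simp
  then have "\<not> inj_on f V" using pigeonhole by blast
  then obtain u v where uv: "u \<in> V" "v \<in> V" "u \<noteq> v" "f u = f v"
    by (auto simp: inj_on_def)
  let ?V = "V - {u, v}"
  have "card (f ` ?V) \<le> c"
    using Suc.prems(1) by (intro order.trans[OF card_mono Suc.prems(2)]) auto
  moreover have "card ?V = card V - 2"
    using uv Suc.prems(1) by (simp add: card_Diff_subset)
  moreover from this have "c + 2 * k \<le> card ?V" using Suc.prems(3) by simp
  ultimately obtain a b :: "nat \<Rightarrow> 'a" where ab: "inj_on a {..<k}" "inj_on b {..<k}"
    "a ` {..<k} \<inter> b ` {..<k} = {}" "a ` {..<k} \<union> b ` {..<k} \<subseteq> ?V" "\<forall>i<k. f (a i) = f (b i)"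
    using Suc.IH[of ?V] Suc.prems(1) by (metis finite_Diff)
  have upd: "g(k := x) ` {..<Suc k} = insert x (g ` {..<k})" for g and x :: 'a
    by (auto simp: lessThan_Suc)
  have inj: "inj_on (g(k := x)) {..<Suc k}" if "inj_on g {..<k}" "x \<notin> g ` {..<k}" for g and x :: 'a
    using that by (auto simp: lessThan_Suc inj_on_def)
  have out: "u \<notin> a ` {..<k}" "v \<notin> b ` {..<k}" "u \<notin> b ` {..<k}" "v \<notin> a ` {..<k}"
    using ab(4) by blast+
  have "inj_on (a(k := u)) {..<Suc k}" "inj_on (b(k := v)) {..<Suc k}"
    using inj ab(1,2) out by auto
  moreover have "a(k := u) ` {..<Suc k} \<inter> b(k := v) ` {..<Suc k} = {}"
    unfolding upd using ab(3) out uv(3) by auto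
  moreover have "a(k := u) ` {..<Suc k} \<union> b(k := v) ` {..<Suc k} \<subseteq> V"
    unfolding upd using ab(4) uv by auto
  moreover have "\<forall>i<Suc k. f ((a(k := u)) i) = f ((b(k := v)) i)"
    using ab(5) uv(4) by (auto simp: less_Suc_eq)
  ultimately show ?case by blast
qed

text \<open>
  In the subgraph induced by the vertices of the tree, every color occurs on both vertices of a
  pair, hence never exactly once.
\<close>

lemma (in pairing) tree_obstructs_centered:
  fixes f :: "'a \<Rightarrow> nat"
  assumes G: "pair_graph G" and V: "a ` {..<m} \<union> b ` {..<m} \<subseteq> pverts G"
    and f: "\<And>i. i < m \<Longrightarrow> f (a i) = f (b i)"
    and \<sigma>: "\<sigma> \<in> placements p m" and \<phi>: "\<phi> \<in> attachments p"
    and arcs: "tree_arcs p a b \<sigma> \<phi> \<subseteq> parcs G"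
  shows "\<not> p_centered (int p) G f"
proof
  assume centered: "p_centered (int p) G f"
  interpret G: pair_graph G by (rule G)
  have sym: "(y, x) \<in> parcs G" if "(x, y) \<in> parcs G" for x y
    using that G.pair_sym_arcs by (auto simp: symmetric_def sym_def)
  define W where "W = a ` \<sigma> ` {..<p} \<union> b ` \<sigma> ` {..<p}"
  have \<sigma>m: "\<sigma> i < m" if "i < p" for i using placement_less[OF \<sigma> that] .
  have WV: "W \<subseteq> pverts G" using V \<sigma>m by (auto simp: W_def)
  have aW: "a (\<sigma> i) \<in> W" and bW: "b (\<sigma> i) \<in> W" if "i < p" for i using that by (auto simp: W_def)
  let ?R = "parcs G \<inter> W \<times> W"
  have reach_a: "(a (\<sigma> 0), a (\<sigma> i)) \<in> ?R\<^sup>*" if "i < p" for i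
    using that
  proof (induction i)
    case 0
    show ?case by simp
  next
    case (Suc i)
    then have "(a (\<sigma> i), a (\<sigma> (Suc i))) \<in> parcs G"
      using arcs by (auto simp: tree_arcs_def)
    then have "(a (\<sigma> i), a (\<sigma> (Suc i))) \<in> ?R" using aW Suc.prems by auto
    with Suc show ?case by (meson Suc_lessD rtrancl.rtrancl_into_rtrancl)
  qed
  have reach_b: "(a (\<sigma> 0), b (\<sigma> i)) \<in> ?R\<^sup>*" if i: "i < p" for i
  proof -
    have \<phi>i: "\<phi> i < p" using attachments_less[OF p2 \<phi> i] .
    have "(b (\<sigma> i), a (\<sigma> (\<phi> i))) \<in> parcs G" using arcs i by (auto simp: tree_arcs_def)
    then have "(a (\<sigma> (\<phi> i)), b (\<sigma> i)) \<in> ?R" using sym aW[OF \<phi>i] bW[OF i] by auto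
    with reach_a[OF \<phi>i] show ?thesis by (rule rtrancl.rtrancl_into_rtrancl)
  qed
  let ?H = "\<lparr>pverts = W, parcs = ?R\<rparr>"
  have "connected_subgraph ?H G"
  proof (rule connected_induced_subgraph[OF G WV aW])
    show "0 < p" using p2 by simp
    fix w assume "w \<in> W"
    then consider i where "i < p" "w = a (\<sigma> i)" | i where "i < p" "w = b (\<sigma> i)"
      by (auto simp: W_def)
    then show "(a (\<sigma> 0), w) \<in> ?R\<^sup>*" using reach_a reach_b by cases auto
  qed
  then have "int (card (f ` W)) > int p \<or> (\<exists>c. card (f -` {c} \<inter> W) = 1)"
    using centered unfolding p_centered_def by fastforce
  moreover have "card (f ` W) \<le> p"
  proof -
    have "f ` W = (\<lambda>i. f (a (\<sigma> i))) ` {..<p}"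
      using f \<sigma>m by (force simp: W_def image_Un image_image)
    then show ?thesis using card_image_le[of "{..<p}"] by simp
  qed
  moreover have "card (f -` {c} \<inter> W) \<noteq> 1" for c
  proof
    assume "card (f -` {c} \<inter> W) = 1"
    then obtain w where w: "f -` {c} \<inter> W = {w}" by (rule card_1_singletonE)
    then obtain i where i: "i < p" "w = a (\<sigma> i) \<or> w = b (\<sigma> i)" by (auto simp: W_def)
    have "w \<in> f -` {c} \<inter> W" unfolding w by simp
    then have "f (a (\<sigma> i)) = c" "f (b (\<sigma> i)) = c"
      using f[OF \<sigma>m[OF i(1)]] i(2) by auto
    then have "a (\<sigma> i) \<in> f -` {c} \<inter> W" "b (\<sigma> i) \<in> f -` {c} \<inter> W"
      using aW[OF i(1)] bW[OF i(1)] by auto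
    then have "a (\<sigma> i) = b (\<sigma> i)" unfolding w by simp
    then show False using a_neq_b \<sigma>m i(1) by auto
  qed
  ultimately show False by auto
qed

section \<open>The random graph\<close>

text \<open>
  The hypotheses \<open>mq\<close> and \<open>sparse\<close> let Janson's inequality apply to the trees on any given disjoint
  pairs, \<open>dense\<close> pays for the union bound over all choices of pairs, and \<open>degree\<close> for the union bound
  over the vertices whose degree might exceed \<open>D\<close>.
\<close>

lemma exists_graph_needing_many_colors:
  fixes p m D :: nat and q :: real
  assumes p: "2 \<le> p" and pm: "2 * p \<le> m" and q: "0 \<le> q" "q \<le> 1"
    and mq: "1 \<le> real m * q\<^sup>2"
    and sparse: "(2 * real p ^ 2) ^ p * q * (real m * q\<^sup>2) ^ (p - 2) \<le> 1 / 2"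
    and dense: "2 * real m * ln (3 * real m) + 1
      \<le> q ^ (2 * p - 1) * (real m / 2) ^ p * real (p div 2) ^ (p - 2) / 2"
    and degree: "3 * real m * (real (6 * m choose Suc D) * q ^ Suc D) < 1 / 2"
  shows "\<exists>G :: nat pair_pre_digraph. pair_graph G \<and> max_degree G \<le> D \<and>
    (\<forall>f. p_centered (int p) G f \<longrightarrow> m < num_colors G f)"
proof -
  \<comment> \<open>\<open>3 * m\<close> vertices leave \<open>m\<close> pairs after at most \<open>m\<close> colors have kept one vertex each.\<close>
  define n where "n = 3 * m"
  define E where "E = {..<n} \<times> {..<n}"
  have E: "finite E" by (simp add: E_def)
  let ?\<Omega> = "({..<m} \<rightarrow>\<^sub>E {..<n}) \<times> ({..<m} \<rightarrow>\<^sub>E {..<n})"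
  define Q where "Q = {(a, b) \<in> ?\<Omega>. pairing m p a b}"
  define none where "none = (\<lambda>(a :: nat \<Rightarrow> nat, b) S. \<forall>A\<in>pairing.tree_family m p a b. \<not> A \<subseteq> S)"
  define star where "star v = {v} \<times> {..<n} \<union> {..<n} \<times> {v}" for v :: nat
  have finO: "finite ?\<Omega>" by (intro finite_cartesian_product finite_PiE) auto
  have finQ: "finite Q" by (rule finite_subset[OF _ finO]) (auto simp: Q_def)
  have m: "0 < m" using p pm by simp
  have "subset_prob E q (\<lambda>S. \<exists>x\<in>Q. none x S) \<le> (\<Sum>x\<in>Q. subset_prob E q (none x))"
    using finQ by (intro subset_prob_Bex q)
  also have "\<dots> \<le> (\<Sum>x\<in>Q. exp (- (2 * real m * ln (3 * real m) + 1)))"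
  proof (rule sum_mono)
    fix x assume x: "x \<in> Q"
    obtain a b where ab: "x = (a, b)" by (cases x)
    interpret pairing m p a b using x by (simp add: Q_def ab)
    have "a ` {..<m} \<union> b ` {..<m} \<subseteq> {..<n}" using x by (auto simp: Q_def ab PiE_iff)
    from avoid_tree_family[OF q mq pm sparse E this E_def]
    have "subset_prob E q (none x)
      \<le> exp (- (q ^ (2 * p - 1) * (real m / 2) ^ p * real (p div 2) ^ (p - 2) / 2))"
      by (simp add: none_def ab)
    also have "\<dots> \<le> exp (- (2 * real m * ln (3 * real m) + 1))" using dense by simp
    finally show "subset_prob E q (none x) \<le> exp (- (2 * real m * ln (3 * real m) + 1))" .
  qed
  also have "\<dots> = real (card Q) * exp (- (2 * real m * ln (3 * real m) + 1))" by simp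
  also have "\<dots> \<le> real n ^ (2 * m) * exp (- (2 * real m * ln (3 * real m) + 1))"
  proof (rule mult_right_mono)
    have "card Q \<le> card ?\<Omega>" by (rule card_mono[OF finO]) (auto simp: Q_def)
    also have "\<dots> = n ^ (2 * m)"
      by (simp add: card_cartesian_product card_funcsetE power_add[symmetric] mult_2)
    finally show "real (card Q) \<le> real n ^ (2 * m)" by (simp only: of_nat_le_iff flip: of_nat_power)
  qed simp
  also have "real n ^ (2 * m) = exp (2 * real m * ln (3 * real m))"
  proof -
    have "real n ^ (2 * m) = exp (ln (real n)) ^ (2 * m)" using m by (simp add: n_def)
    then show ?thesis by (simp add: n_def exp_of_nat_mult[symmetric])
  qed
  also have "exp (2 * real m * ln (3 * real m)) * exp (- (2 * real m * ln (3 * real m) + 1)) = exp (- 1)"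
    by (simp add: exp_add[symmetric])
  also have "exp (- 1 :: real) \<le> 1 / 2"
    using exp_ge_add_one_self[of "1 :: real"] by (simp add: exp_minus field_simps)
  finally have bad1: "subset_prob E q (\<lambda>S. \<exists>x\<in>Q. none x S) \<le> 1 / 2" .
  have "subset_prob E q (\<lambda>S. \<exists>v\<in>{..<n}. Suc D \<le> card (S \<inter> star v))
    \<le> (\<Sum>v\<in>{..<n}. subset_prob E q (\<lambda>S. Suc D \<le> card (S \<inter> star v)))"
    by (intro subset_prob_Bex q) simp
  also have "\<dots> \<le> (\<Sum>v\<in>{..<n}. real (6 * m choose Suc D) * q ^ Suc D)"
  proof (rule sum_mono)
    fix v assume v: "v \<in> {..<n}"
    have "subset_prob E q (\<lambda>S. Suc D \<le> card (S \<inter> star v)) \<le> real (card (star v) choose Suc D) * q ^ Suc D"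
      using v by (intro subset_prob_card_ge q E) (auto simp: star_def E_def)
    also have "\<dots> \<le> real (6 * m choose Suc D) * q ^ Suc D"
    proof (rule mult_right_mono)
      have "card (star v) \<le> card ({v} \<times> {..<n}) + card ({..<n} \<times> {v})"
        unfolding star_def by (rule card_Un_le)
      then have "card (star v) \<le> 6 * m" by (simp add: card_cartesian_product n_def)
      then show "real (card (star v) choose Suc D) \<le> real (6 * m choose Suc D)"
        by (intro of_nat_mono binomial_right_mono)
    qed (use q in simp)
    finally show "subset_prob E q (\<lambda>S. Suc D \<le> card (S \<inter> star v))
      \<le> real (6 * m choose Suc D) * q ^ Suc D" .
  qed
  also have "\<dots> < 1 / 2" using degree by (simp add: n_def)
  finally have bad2: "subset_prob E q (\<lambda>S. \<exists>v\<in>{..<n}. Suc D \<le> card (S \<inter> star v)) < 1 / 2" .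
  have "subset_prob E q (\<lambda>S. (\<exists>x\<in>Q. none x S) \<or> (\<exists>v\<in>{..<n}. Suc D \<le> card (S \<inter> star v))) < 1"
    using subset_prob_disj[OF q, of E "\<lambda>S. \<exists>x\<in>Q. none x S" "\<lambda>S. \<exists>v\<in>{..<n}. Suc D \<le> card (S \<inter> star v)"]
      bad1 bad2 by linarith
  from subset_prob_ex[OF q E this] obtain S where S: "\<And>x. x \<in> Q \<Longrightarrow> \<not> none x S"
    "\<And>v. v < n \<Longrightarrow> card (S \<inter> star v) \<le> D"
    by (auto simp: not_less_eq_eq)
  let ?G = "symmetric_graph n S"
  have G: "pair_graph ?G" by (rule pair_graph_symmetric_graph)
  have "m < num_colors ?G f" if f: "p_centered (int p) ?G f" for f
  proof (rule ccontr)
    assume "\<not> m < num_colors ?G f"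
    then have "card (f ` {..<n}) \<le> m" by (simp add: num_colors_def symmetric_graph_def)
    then obtain a0 b0 :: "nat \<Rightarrow> nat" where ab0: "inj_on a0 {..<m}" "inj_on b0 {..<m}"
      "a0 ` {..<m} \<inter> b0 ` {..<m} = {}" "a0 ` {..<m} \<union> b0 ` {..<m} \<subseteq> {..<n}"
      "\<forall>i<m. f (a0 i) = f (b0 i)"
      using monochromatic_pairs[of "{..<n}" f m m] by (auto simp: n_def)
    define a b where "a = restrict a0 {..<m}" and "b = restrict b0 {..<m}"
    have ab: "a i = a0 i" "b i = b0 i" if "i < m" for i using that by (auto simp: a_def b_def)
    have img: "a ` {..<m} = a0 ` {..<m}" "b ` {..<m} = b0 ` {..<m}" by (auto simp: ab)
    interpret pairing m p a b
    proof
      show "inj_on a {..<m}" "inj_on b {..<m}"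
        using ab0(1,2) by (auto simp: a_def b_def inj_on_restrict_eq)
      show "a ` {..<m} \<inter> b ` {..<m} = {}" unfolding img by (rule ab0(3))
    qed (rule p)
    have "(a, b) \<in> Q"
      using ab0(4) pairing_axioms by (auto simp: Q_def a_def b_def)
    from S(1)[OF this] obtain \<sigma> \<phi> where \<sigma>: "\<sigma> \<in> placements p m" and \<phi>: "\<phi> \<in> attachments p"
      and sub: "tree_arcs p a b \<sigma> \<phi> \<subseteq> S"
      by (auto simp: none_def tree_family_def)
    have lt: "a (\<sigma> i) < n" "b (\<sigma> i) < n" if "i < p" for i
      using ab0(4) placement_less[OF \<sigma> that] by (auto simp: ab)
    note less = attachments_less[OF p \<phi>]
    have "tree_arcs p a b \<sigma> \<phi> \<subseteq> parcs ?G"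
    proof
      fix e assume e: "e \<in> tree_arcs p a b \<sigma> \<phi>"
      have "fst e < n" "snd e < n" "fst e \<noteq> snd e"
        using e lt less placement_less[OF \<sigma>]
        by (auto simp: tree_arcs_def a_eq_iff placement_eq_iff[OF \<sigma>] a_neq_b[symmetric])
      then show "e \<in> parcs ?G" using e sub by (cases e) (auto simp: symmetric_graph_def)
    qed
    moreover have "a ` {..<m} \<union> b ` {..<m} \<subseteq> pverts ?G"
      unfolding img using ab0(4) by (simp add: symmetric_graph_def)
    moreover have "f (a i) = f (b i)" if "i < m" for i using ab0(5) that by (simp add: ab)
    ultimately show False using tree_obstructs_centered[OF G _ _ \<sigma> \<phi>] f by blast
  qed
  moreover have "max_degree ?G \<le> D"
    using S(2) by (intro max_degree_symmetric_graph) (simp add: star_def)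
  ultimately show ?thesis using G by blast
qed

text \<open>
  A 1-centered coloring is proper: an edge whose ends have the same color would be a connected
  subgraph with a single color, which occurs on two vertices.
\<close>

lemma complete_graph_needs_many_colors:
  "\<exists>G :: nat pair_pre_digraph. pair_graph G \<and> max_degree G \<le> D \<and>
    (\<forall>f. p_centered 1 G f \<longrightarrow> D < num_colors G f)"
proof -
  let ?S = "{(u, v). u < v}"
  let ?G = "symmetric_graph (Suc D) ?S"
  have G: "pair_graph ?G" by (rule pair_graph_symmetric_graph)
  have "max_degree ?G \<le> D"
  proof (rule max_degree_symmetric_graph)
    fix v assume v: "v < Suc D"
    let ?X = "?S \<inter> ({v} \<times> {..<Suc D} \<union> {..<Suc D} \<times> {v})"
    have "?X \<subseteq> (\<lambda>u. (min u v, max u v)) ` ({..<Suc D} - {v})"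
      by (force simp: image_iff min_def max_def)
    then have "card ?X \<le> card ({..<Suc D} - {v})"
      by (meson surj_card_le finite_Diff finite_lessThan)
    then show "card ?X \<le> D" using v by simp
  qed
  moreover have "D < num_colors ?G f" if f: "p_centered 1 ?G f" for f
  proof -
    have "inj_on f {..<Suc D}"
    proof (rule inj_onI, rule ccontr)
      fix u v assume uv: "u \<in> {..<Suc D}" "v \<in> {..<Suc D}" "f u = f v" "u \<noteq> v"
      let ?W = "{u, v}"
      have "(u, v) \<in> parcs ?G" using uv by (auto simp: symmetric_graph_def)
      then have "connected_subgraph \<lparr>pverts = ?W, parcs = parcs ?G \<inter> ?W \<times> ?W\<rparr> ?G"
        using uv by (intro connected_induced_subgraph[OF G, of _ u]) (auto simp: symmetric_graph_def)
      then have "int (card (f ` ?W)) > 1 \<or> (\<exists>c. card (f -` {c} \<inter> ?W) = 1)"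
        using f unfolding p_centered_def by fastforce
      moreover have "f -` {c} \<inter> ?W = (if c = f u then ?W else {})" for c using uv(3) by auto
      ultimately show False using uv(3,4) by (auto split: if_splits)
    qed
    then show ?thesis by (simp add: num_colors_def symmetric_graph_def card_image)
  qed
  ultimately show ?thesis using G by blast
qed

section \<open>Choice of the parameters\<close>

definition color_bound :: "nat \<Rightarrow> real \<Rightarrow> real" where
  "color_bound p x = 1 / 10 ^ 6 * x powr (2 - 1 / real p) * real p * ln x powr (- 1 / real p)"

lemma power_le_fact_times_3_power: "real k ^ k \<le> fact k * 3 ^ k"
proof -
  have "real k ^ k /\<^sub>R fact k \<le> (\<Sum>n. real k ^ n /\<^sub>R fact n)"
    using summable_exp_generic[of "real k"]
    by (intro sum_le_suminf[of _ "{k}", simplified]) auto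
  then have "real k ^ k / fact k \<le> exp (real k)"
    by (simp add: exp_def divide_inverse mult.commute)
  also have "exp (real k) = exp 1 ^ k" by (simp add: exp_of_nat_mult[symmetric])
  also have "\<dots> \<le> 3 ^ k" using exp_le by (intro power_mono) auto
  finally show ?thesis by (simp add: field_simps)
qed

text \<open>
  The sum over overlapping trees is the subtle one of these conditions: its exponents nearly cancel.
  With \<open>t\<close> of order \<open>x powr (2 - e) * ln x powr (- e)\<close>, \<open>e = 1 / p\<close>, it is of order
  \<open>x powr (- e) * ln x powr (1 - e)\<close>, and so it still tends to 0.
\<close>

lemma eventually_color_bound:
  assumes p: "2 \<le> p"
  defines "t \<equiv> color_bound p"
  shows "\<forall>\<^sub>F x in at_top. 3 \<le> x \<and> 2 * real p \<le> t x \<and> x \<le> t x \<and> 10368 * t x \<le> x\<^sup>2 \<and> 6 * t x \<le> x ^ 3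
    \<and> (2 * real p ^ 2) ^ p * (x / (72 * t x)) * (x\<^sup>2 / (5184 * t x)) ^ (p - 2) \<le> 1 / 2
    \<and> x ^ 3 * (1 / 4) powr x < 1 / 2"
proof -
  define e where "e = 1 / real p"
  define A where "A = real p / 10 ^ 6"
  have e: "0 < e" "e \<le> 1 / 2" using p by (auto simp: e_def field_simps)
  have A: "0 < A" using p by (simp add: A_def)
  have t: "t x = A * x powr (2 - e) * ln x powr (- e)" for x
    by (simp add: t_def color_bound_def A_def e_def)
  have lim_t: "filterlim t at_top at_top"
    unfolding t[abs_def] using e A by real_asymp
  have t_pos: "0 < t x" if "3 \<le> x" for x
    using A that ln_gt_zero[of x] by (auto simp: t)
  have xt: "x / t x = (x powr (e - 1) * ln x powr e) / A" if "3 \<le> x" for x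
  proof -
    have "(x powr (e - 1) * ln x powr e) * (x powr (2 - e) * ln x powr (- e))
      = (x powr (e - 1) * x powr (2 - e)) * (ln x powr e * ln x powr (- e))" by (simp only: mult_ac)
    also have "\<dots> = x" using that ln_gt_zero[of x] by (simp flip: powr_add)
    finally have *: "(x powr (e - 1) * ln x powr e) * (x powr (2 - e) * ln x powr (- e)) = x" .
    have "x powr (2 - e) * ln x powr (- e) \<noteq> 0" using that ln_gt_zero[of x] by simp
    then have "(x powr (e - 1) * ln x powr e) * (x powr (2 - e) * ln x powr (- e)) / t x
        = (x powr (e - 1) * ln x powr e) / A"
      by (simp add: t mult.assoc)
    then show ?thesis unfolding * .
  qed
  have x2t: "x\<^sup>2 / t x = (x powr e * ln x powr e) / A" if "3 \<le> x" for x
  proof -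
    have "x\<^sup>2 / t x = x * (x / t x)" by (simp add: power2_eq_square)
    also have "\<dots> = (x powr 1 * x powr (e - 1) * ln x powr e) / A"
      using that by (simp add: xt)
    also have "x powr 1 * x powr (e - 1) = x powr e" by (subst powr_add[symmetric]) simp
    finally show ?thesis .
  qed
  define C where "C = (2 * real p ^ 2) ^ p * (1 / (72 * A)) * (1 / (5184 * A)) ^ (p - 2)"
  have sparse: "(2 * real p ^ 2) ^ p * (x / (72 * t x)) * (x\<^sup>2 / (5184 * t x)) ^ (p - 2)
    = C * (x powr (- e) * ln x powr (1 - e))" if x: "3 \<le> x" for x
  proof -
    have L: "0 < ln x" using x ln_gt_zero[of x] by simp
    have 1: "x / (72 * t x) = 1 / (72 * A) * (x powr (e - 1) * ln x powr e)"
      using xt[OF x] by (simp add: field_simps)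
    have 2: "x\<^sup>2 / (5184 * t x) = 1 / (5184 * A) * (x powr e * ln x powr e)"
      using x2t[OF x] by (simp add: field_simps)
    have "(x powr e * ln x powr e) ^ (p - 2)
      = x powr (e * real (p - 2)) * ln x powr (e * real (p - 2))"
      using x L by (simp add: power_mult_distrib powr_powr flip: powr_realpow)
    moreover have "e * real (p - 2) = 1 - 2 * e" using p by (simp add: e_def field_simps of_nat_diff)
    ultimately have pw: "(x powr e * ln x powr e) ^ (p - 2) = x powr (1 - 2 * e) * ln x powr (1 - 2 * e)"
      by simp
    have "x powr (e - 1) * ln x powr e * (x powr (1 - 2 * e) * ln x powr (1 - 2 * e))
      = (x powr (e - 1) * x powr (1 - 2 * e)) * (ln x powr e * ln x powr (1 - 2 * e))"
      by (simp only: mult_ac)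
    also have "\<dots> = x powr (- e) * ln x powr (1 - e)" by (simp flip: powr_add)
    finally have comb: "x powr (e - 1) * ln x powr e * (x powr (1 - 2 * e) * ln x powr (1 - 2 * e))
      = x powr (- e) * ln x powr (1 - e)" .
    show ?thesis unfolding 1 2 power_mult_distrib[of "1 / (5184 * A)"] pw C_def comb[symmetric]
      by (simp only: mult_ac)
  qed
  have ge3: "\<forall>\<^sub>F x :: real in at_top. 3 \<le> x" by (rule eventually_ge_at_top)
  have 1: "\<forall>\<^sub>F x in at_top. 2 * real p \<le> t x"
    using lim_t by (simp add: filterlim_at_top)
  have "((\<lambda>x. (x powr (e - 1) * ln x powr e) / A) \<longlongrightarrow> 0) at_top" using e A by real_asymp
  then have "\<forall>\<^sub>F x in at_top. (x powr (e - 1) * ln x powr e) / A < 1"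
    by (rule order_tendstoD) simp
  with ge3 have 2: "\<forall>\<^sub>F x in at_top. x \<le> t x"
  proof eventually_elim
    case (elim x)
    then have "x / t x < 1" using xt[of x] by simp
    then show ?case using t_pos[of x] elim(1) by (simp add: divide_less_eq)
  qed
  have "filterlim (\<lambda>x. (x powr e * ln x powr e) / A) at_top at_top" using e A by real_asymp
  then have "\<forall>\<^sub>F x in at_top. 10368 \<le> (x powr e * ln x powr e) / A" by (simp add: filterlim_at_top)
  with ge3 have 3: "\<forall>\<^sub>F x in at_top. 10368 * t x \<le> x\<^sup>2"
  proof eventually_elim
    case (elim x)
    then have "10368 \<le> x\<^sup>2 / t x" using x2t[of x] by simp
    then show ?case using t_pos[of x] elim(1) by (simp add: le_divide_eq)
  qed
  with ge3 2 have 4: "\<forall>\<^sub>F x in at_top. 6 * t x \<le> x ^ 3"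
  proof eventually_elim
    case (elim x)
    have "6 * t x \<le> x\<^sup>2 * 1" using elim by simp
    also have "\<dots> \<le> x\<^sup>2 * x" using elim by (intro mult_left_mono) auto
    finally show ?case by (simp add: power3_eq_cube power2_eq_square)
  qed
  have "((\<lambda>x. C * (x powr (- e) * ln x powr (1 - e))) \<longlongrightarrow> C * 0) at_top"
    using e by (intro tendsto_mult_left) real_asymp
  then have "\<forall>\<^sub>F x in at_top. C * (x powr (- e) * ln x powr (1 - e)) < 1 / 2"
    by (rule order_tendstoD) simp
  with ge3 have 5: "\<forall>\<^sub>F x in at_top.
      (2 * real p ^ 2) ^ p * (x / (72 * t x)) * (x\<^sup>2 / (5184 * t x)) ^ (p - 2) \<le> 1 / 2"
  proof eventually_elim
    case (elim x)
    then show ?case using sparse[of x] by simp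
  qed
  have "((\<lambda>x :: real. x ^ 3 * (1 / 4) powr x) \<longlongrightarrow> 0) at_top" by real_asymp
  then have 6: "\<forall>\<^sub>F x :: real in at_top. x ^ 3 * (1 / 4) powr x < 1 / 2"
    by (rule order_tendstoD) simp
  from ge3 1 2 3 4 5 6 show ?thesis by eventually_elim simp
qed

lemma color_bound_power:
  assumes "2 \<le> p" "1 < x"
  shows "color_bound p x ^ p * ln x = (real p / 10 ^ 6) ^ p * x ^ (2 * p - 1)"
proof -
  have L: "0 < ln x" using assms by simp
  have "(2 - 1 / real p) * real p = real (2 * p - 1)"
    using assms by (simp add: of_nat_diff field_simps)
  then have "(x powr (2 - 1 / real p)) ^ p = x powr real (2 * p - 1)"
    using assms by (simp add: powr_powr flip: powr_realpow)
  also have "\<dots> = x ^ (2 * p - 1)" using assms by (intro powr_realpow) simp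
  finally have 1: "(x powr (2 - 1 / real p)) ^ p = x ^ (2 * p - 1)" .
  have "(ln x powr (- 1 / real p)) ^ p = ln x powr (- 1)"
    using assms L by (simp add: powr_powr flip: powr_realpow)
  then have 2: "(ln x powr (- 1 / real p)) ^ p * ln x = 1"
    using L by (simp add: powr_minus)
  have "color_bound p x ^ p * ln x = (real p / 10 ^ 6) ^ p * (x powr (2 - 1 / real p)) ^ p
      * ((ln x powr (- 1 / real p)) ^ p * ln x)"
    by (simp add: color_bound_def power_mult_distrib power_divide)
  then show ?thesis unfolding 1 2 by simp
qed

text \<open>
  This compares the number of attachments with \<open>p ^ p\<close>.  The loss is exponential in \<open>p\<close>, and after
  taking \<open>p\<close>-th roots it is only a constant factor in the number of colors.
\<close>

lemma half_power_bound:
  assumes "2 \<le> p"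
  shows "9 * (real p / 12) ^ p \<le> real (p div 2) ^ (p - 2)"
proof -
  have "p < 2 ^ p" by (rule less_exp)
  then have "real p \<le> 2 ^ p" by (metis less_imp_le of_nat_le_iff of_nat_numeral of_nat_power)
  then have "real p ^ 2 \<le> (2 ^ p) ^ 2" by (intro power_mono) auto
  then have p4: "real p ^ 2 \<le> 4 ^ p" by (simp add: power2_eq_square flip: power_mult_distrib)
  have cancel: "9 * (y * (real p / 3) ^ 2) / real p ^ 2 = y" for y
    using assms by (simp add: power2_eq_square)
  have "9 * (real p / 12) ^ p = 9 * (real p / 3) ^ p / 4 ^ p"
    by (simp add: power_divide flip: power_mult_distrib)
  also have "\<dots> \<le> 9 * (real p / 3) ^ p / real p ^ 2"
    using p4 assms by (intro divide_left_mono) auto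
  also have "(real p / 3) ^ p = (real p / 3) ^ (p - 2) * (real p / 3) ^ 2"
    using assms by (metis le_add_diff_inverse2 power_add)
  also have "9 * ((real p / 3) ^ (p - 2) * (real p / 3) ^ 2) / real p ^ 2 = (real p / 3) ^ (p - 2)"
    by (rule cancel)
  also have "\<dots> \<le> real (p div 2) ^ (p - 2)"
  proof (rule power_mono)
    have "p \<le> 3 * (p div 2)" using assms by presburger
    then show "real p / 3 \<le> real (p div 2)" by linarith
  qed simp
  finally show ?thesis .
qed

text \<open>
  The left side is the union bound for the event that a binomial distribution with mean \<open>y\<close> takes
  a value of at least \<open>k\<close>.
\<close>

lemma binomial_tail_bound:
  assumes "0 \<le> y" "12 * y \<le> real k"
  shows "real (n choose k) * (y / real n) ^ k \<le> (1 / 4) ^ k"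
proof (cases "n = 0")
  case True
  then show ?thesis by (cases k) auto
next
  case False
  have "real (n choose k) * fact k \<le> real n ^ k"
    using binomial_fact_pow[of n k] by (metis of_nat_fact of_nat_le_iff of_nat_mult of_nat_power)
  then have "real (n choose k) * fact k * (y / real n) ^ k \<le> real n ^ k * (y / real n) ^ k"
    using assms(1) by (intro mult_right_mono) auto
  also have "\<dots> = y ^ k" using False by (simp flip: power_mult_distrib)
  also have "\<dots> \<le> (real k / 12) ^ k" using assms by (intro power_mono) auto
  also have "\<dots> = real k ^ k / 12 ^ k" by (simp add: power_divide)
  also have "\<dots> \<le> fact k * 3 ^ k / 12 ^ k"
    by (intro divide_right_mono power_le_fact_times_3_power) simp
  also have "\<dots> = fact k * (3 / 12) ^ k" by (simp only: power_divide times_divide_eq_right)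
  finally show ?thesis by (simp add: mult_ac)
qed

text \<open>
  Multiplied by \<open>m ^ (p - 1)\<close>, the left side is at most a constant times \<open>m ^ p * ln x\<close>,
  where \<open>m\<close> may be replaced by twice the color bound, and the right side no longer depends on \<open>m\<close>.  By \<open>color_bound_power\<close> both
  sides are then, up to constant factors, \<open>x ^ (2 * p - 1)\<close> times a \<open>p\<close>-th power: of \<open>2 * p / 10 ^ 6\<close> on the
  left, and \<open>p / 124416\<close> with \<open>124416 = 72 ^ 2 * 2 * 12\<close> on the right.  This is where the constant
  \<open>10 ^ 6\<close> is chosen.
\<close>

lemma dense_bound:
  fixes m p :: nat
  assumes p: "2 \<le> p" and x: "3 \<le> x" and t: "1 \<le> color_bound p x" "6 * color_bound p x \<le> x ^ 3"
    and m: "1 \<le> m" "real m \<le> 2 * color_bound p x"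
  shows "2 * real m * ln (3 * real m) + 1
    \<le> (x / (72 * real m)) ^ (2 * p - 1) * (real m / 2) ^ p * real (p div 2) ^ (p - 2) / 2"
proof -
  let ?t = "color_bound p x" and ?M = "real m"
  have x1: "1 < x" and L: "0 < ln x" using x by simp_all
  have M: "1 \<le> ?M" using m by simp
  have "1 = ln (exp (1 :: real))" by simp
  also have "\<dots> \<le> ln (3 * ?M)" using exp_le M by (subst ln_le_cancel_iff) auto
  finally have ln1: "1 \<le> ln (3 * ?M)" .
  have "ln (3 * ?M) \<le> ln (x ^ 3)" using m t M x by (subst ln_le_cancel_iff) auto
  also have "\<dots> = 3 * ln x" using x by (simp add: ln_realpow)
  finally have ln3: "ln (3 * ?M) \<le> 3 * ln x" .
  have "1 * 1 \<le> ?M * ln (3 * ?M)" using ln1 M by (intro mult_mono) auto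
  then have "2 * ?M * ln (3 * ?M) + 1 \<le> ?M * (3 * ln (3 * ?M))" by simp
  also have "\<dots> \<le> ?M * (9 * ln x)" using ln3 M by (intro mult_left_mono) auto
  finally have lhs: "2 * ?M * ln (3 * ?M) + 1 \<le> ?M * (9 * ln x)" .
  have "?M * (9 * ln x) * ?M ^ (p - 1) = 9 * (?M ^ p * ln x)"
    using p by (simp add: power_eq_if)
  also have "?M ^ p * ln x \<le> (2 * ?t) ^ p * ln x"
    using m L by (intro mult_right_mono power_mono) auto
  also have "(2 * ?t) ^ p * ln x = 2 ^ p * (?t ^ p * ln x)" by (simp add: power_mult_distrib)
  also have "\<dots> = (2 * (real p / 10 ^ 6)) ^ p * x ^ (2 * p - 1)"
    unfolding color_bound_power[OF p x1] by (simp only: power_mult_distrib mult.assoc)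
  also have "\<dots> \<le> (real p / 124416) ^ p * x ^ (2 * p - 1)"
    using x by (intro mult_right_mono power_mono) auto
  finally have upper: "?M * (9 * ln x) * ?M ^ (p - 1) \<le> 9 * ((real p / 124416) ^ p * x ^ (2 * p - 1))"
    by simp
  have e: "2 * p - 1 = (p - 1) + p" using p by simp
  have "(x / (72 * ?M)) ^ (2 * p - 1) * (?M / 2) ^ p * real (p div 2) ^ (p - 2) / 2 * ?M ^ (p - 1)
    = (x / 72) ^ (2 * p - 1) * (1 / 2) ^ p * real (p div 2) ^ (p - 2) / 2"
  proof -
    have "(x / (72 * ?M)) ^ (2 * p - 1) = (x / 72) ^ (2 * p - 1) / (?M ^ (p - 1) * ?M ^ p)"
      unfolding power_add[symmetric] e[symmetric] by (simp add: power_divide power_mult_distrib)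
    moreover have "(?M / 2) ^ p = ?M ^ p * (1 / 2) ^ p" by (simp add: power_divide)
    ultimately show ?thesis using M by simp
  qed
  also have "\<dots> \<ge> (x / 72) ^ (2 * p - 1) * (1 / 2) ^ p * (9 * (real p / 12) ^ p) / 2"
    using half_power_bound[OF p] x by (intro divide_right_mono mult_left_mono) auto
  also have "(x / 72) ^ (2 * p - 1) * (1 / 2) ^ p * (9 * (real p / 12) ^ p) / 2
    = 324 * ((real p / 124416) ^ p * x ^ (2 * p - 1))"
  proof -
    have "(72 :: real) ^ (2 * p - 1) * 72 = 72 ^ (2 * p)"
      using p by (simp flip: power_Suc2)
    then have pow72: "(72 :: real) ^ (2 * p - 1) = 5184 ^ p / 72" by (simp add: power_mult)
    have "(x / 72) ^ (2 * p - 1) = 72 * (1 / 5184) ^ p * x ^ (2 * p - 1)"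
      unfolding power_divide[of x] pow72 by (simp add: power_divide)
    then have "(x / 72) ^ (2 * p - 1) * (1 / 2) ^ p * (9 * (real p / 12) ^ p) / 2
      = 324 * ((1 / 5184) ^ p * (1 / 2) ^ p * (real p / 12) ^ p * x ^ (2 * p - 1))" by simp
    then show ?thesis by (simp flip: power_mult_distrib)
  qed
  finally have lower: "324 * ((real p / 124416) ^ p * x ^ (2 * p - 1))
    \<le> (x / (72 * ?M)) ^ (2 * p - 1) * (?M / 2) ^ p * real (p div 2) ^ (p - 2) / 2 * ?M ^ (p - 1)" .
  have "0 \<le> (real p / 124416) ^ p * x ^ (2 * p - 1)" using x by simp
  then have "?M * (9 * ln x) * ?M ^ (p - 1)
    \<le> (x / (72 * ?M)) ^ (2 * p - 1) * (?M / 2) ^ p * real (p div 2) ^ (p - 2) / 2 * ?M ^ (p - 1)"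
    using upper lower by linarith
  then have "?M * (9 * ln x)
    \<le> (x / (72 * ?M)) ^ (2 * p - 1) * (?M / 2) ^ p * real (p div 2) ^ (p - 2) / 2"
    using M by (subst (asm) mult_le_cancel_right_pos) auto
  then show ?thesis using lhs by linarith
qed

lemma exists_graph_exceeding_color_bound:
  fixes p D :: nat
  defines "x \<equiv> real D" and "t \<equiv> color_bound p (real D)"
  assumes p: "2 \<le> p" and D: "3 \<le> x" "2 * real p \<le> t" "x \<le> t" "10368 * t \<le> x\<^sup>2" "6 * t \<le> x ^ 3"
    "(2 * real p ^ 2) ^ p * (x / (72 * t)) * (x\<^sup>2 / (5184 * t)) ^ (p - 2) \<le> 1 / 2"
    "x ^ 3 * (1 / 4) powr x < 1 / 2"
  shows "\<exists>G :: nat pair_pre_digraph. pair_graph G \<and> max_degree G \<le> D \<and>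
    (\<forall>f. p_centered (int p) G f \<longrightarrow> t \<le> real (num_colors G f))"
proof -
  \<comment> \<open>The least value of \<open>m\<close> that is good enough, and an edge probability that keeps the mean
    degree a constant factor below \<open>D\<close>, so that no degree is likely to exceed \<open>D\<close>.\<close>
  define m where "m = nat \<lceil>t\<rceil>"
  define q where "q = x / (72 * real m)"
  have m: "t \<le> real m" "real m \<le> 2 * t" unfolding m_def using D(1,3) by linarith+
  have m0: "1 \<le> m" using m(1) D(1,3) by linarith
  have q: "0 \<le> q" "q \<le> 1" using D(1,3) m m0 by (auto simp: q_def field_simps)
  have mq2: "real m * q\<^sup>2 = x\<^sup>2 / (5184 * real m)"
    using m0 by (simp add: q_def power2_eq_square)
  have "\<exists>G :: nat pair_pre_digraph. pair_graph G \<and> max_degree G \<le> D \<and>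
    (\<forall>f. p_centered (int p) G f \<longrightarrow> m < num_colors G f)"
  proof (rule exists_graph_needing_many_colors[OF p _ q])
    show "2 * p \<le> m" using D(2) m(1) by linarith
    show "1 \<le> real m * q\<^sup>2" unfolding mq2 using D(4) m m0 by (simp add: field_simps)
    have "q \<le> x / (72 * t)" unfolding q_def using m D by (intro divide_left_mono) auto
    moreover have "real m * q\<^sup>2 \<le> x\<^sup>2 / (5184 * t)"
      unfolding mq2 using m D by (intro divide_left_mono) auto
    ultimately have "(2 * real p ^ 2) ^ p * q * (real m * q\<^sup>2) ^ (p - 2)
      \<le> (2 * real p ^ 2) ^ p * (x / (72 * t)) * (x\<^sup>2 / (5184 * t)) ^ (p - 2)"
      using q D(1,3) by (intro mult_mono power_mono) auto
    then show "(2 * real p ^ 2) ^ p * q * (real m * q\<^sup>2) ^ (p - 2) \<le> 1 / 2" using D(6) by linarith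
    show "2 * real m * ln (3 * real m) + 1
      \<le> q ^ (2 * p - 1) * (real m / 2) ^ p * real (p div 2) ^ (p - 2) / 2"
      unfolding q_def using D m m0 by (intro dense_bound[OF p]) (auto simp: x_def t_def)
    \<comment> \<open>A degree is governed by at most \<open>6 * m\<close> ordered pairs, so its mean is at most \<open>x / 12\<close>.\<close>
    have "q = x / 12 / real (6 * m)" by (simp add: q_def)
    moreover have "real (6 * m choose Suc D) * (x / 12 / real (6 * m)) ^ Suc D \<le> (1 / 4) ^ Suc D"
      by (rule binomial_tail_bound) (auto simp: x_def)
    moreover have "(1 / 4 :: real) ^ Suc D \<le> (1 / 4) ^ D" by (intro power_decreasing) auto
    ultimately have "real (6 * m choose Suc D) * q ^ Suc D \<le> (1 / 4) ^ D" by (metis order_trans)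
    moreover have "3 * real m \<le> x ^ 3" using m(2) D(5) by linarith
    ultimately have "3 * real m * (real (6 * m choose Suc D) * q ^ Suc D) \<le> x ^ 3 * (1 / 4) ^ D"
      using q D(1) by (intro mult_mono) auto
    also have "(1 / 4 :: real) ^ D = (1 / 4) powr x" unfolding x_def by (simp add: powr_realpow)
    also have "x ^ 3 * (1 / 4) powr x < 1 / 2" by (rule D(7))
    finally show "3 * real m * (real (6 * m choose Suc D) * q ^ Suc D) < 1 / 2" .
  qed
  then show ?thesis using m(1) by (meson less_imp_le of_nat_le_iff order_trans)
qed

theorem theorem1p3:
  shows "\<exists>c::real. c > 0 \<and>
    (\<forall>p::int. p \<ge> 1 \<longrightarrow>
      (\<exists>\<Delta>\<^sub>p::int. \<forall>\<Delta>::int. \<Delta> \<ge> \<Delta>\<^sub>p \<longrightarrow>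
        (\<exists>G :: nat pair_pre_digraph. pair_graph G \<and> int (max_degree G) \<le> \<Delta> \<and>
          (\<forall>f. p_centered p G f \<longrightarrow>
            real (num_colors G f) \<ge>
              c * real_of_int \<Delta> powr (2 - 1 / real_of_int p) * real_of_int p *
              ln (real_of_int \<Delta>) powr (- 1 / real_of_int p)))))"
proof (intro exI[of _ "1 / 10 ^ 6 :: real"] conjI allI impI)
  show "(0 :: real) < 1 / 10 ^ 6" by simp
  fix p :: int assume p: "1 \<le> p"
  define P where "P = nat p"
  have P: "p = int P" "1 \<le> P" using p by (auto simp: P_def)
  have "\<exists>X. \<forall>D::nat. X \<le> real D \<longrightarrow> (\<exists>G :: nat pair_pre_digraph. pair_graph G \<and> max_degree G \<le> D \<and>
    (\<forall>f. p_centered (int P) G f \<longrightarrow> color_bound P (real D) \<le> real (num_colors G f)))"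
  proof (cases "P = 1")
    case True
    show ?thesis
    proof (intro exI[of _ 3] allI impI)
      fix D :: nat assume D: "3 \<le> real D"
      have "1 = ln (exp (1 :: real))" by simp
      also have "\<dots> \<le> ln (real D)" using D exp_le by (subst ln_le_cancel_iff) auto
      finally have "1 \<le> ln (real D)" .
      then have "color_bound P (real D) \<le> real D"
        using True D by (simp add: color_bound_def powr_minus field_simps)
      moreover obtain G :: "nat pair_pre_digraph" where "pair_graph G" "max_degree G \<le> D"
        "\<forall>f. p_centered 1 G f \<longrightarrow> D < num_colors G f"
        using complete_graph_needs_many_colors by blast
      ultimately show "\<exists>G :: nat pair_pre_digraph. pair_graph G \<and> max_degree G \<le> D \<and>
        (\<forall>f. p_centered (int P) G f \<longrightarrow> color_bound P (real D) \<le> real (num_colors G f))"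
        using True by (intro exI[of _ G]) force
    qed
  next
    case False
    then have P2: "2 \<le> P" using P by simp
    show ?thesis
      using eventually_color_bound[OF P2] exists_graph_exceeding_color_bound[OF P2]
      unfolding eventually_at_top_linorder by metis
  qed
  then obtain X where X: "\<And>D::nat. X \<le> real D \<Longrightarrow>
    (\<exists>G :: nat pair_pre_digraph. pair_graph G \<and> max_degree G \<le> D \<and>
    (\<forall>f. p_centered (int P) G f \<longrightarrow> color_bound P (real D) \<le> real (num_colors G f)))"
    by blast
  show "\<exists>\<Delta>\<^sub>p::int. \<forall>\<Delta>::int. \<Delta> \<ge> \<Delta>\<^sub>p \<longrightarrow>
    (\<exists>G :: nat pair_pre_digraph. pair_graph G \<and> int (max_degree G) \<le> \<Delta> \<and>
      (\<forall>f. p_centered p G f \<longrightarrow>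
        real (num_colors G f) \<ge>
          1 / 10 ^ 6 * real_of_int \<Delta> powr (2 - 1 / real_of_int p) * real_of_int p *
          ln (real_of_int \<Delta>) powr (- 1 / real_of_int p)))"
  proof (intro exI[of _ "max 0 \<lceil>X\<rceil>"] allI impI)
    fix \<Delta> :: int assume \<Delta>: "max 0 \<lceil>X\<rceil> \<le> \<Delta>"
    define D where "D = nat \<Delta>"
    have D: "\<Delta> = int D" using \<Delta> by (simp add: D_def)
    have "X \<le> real D" using \<Delta> by (simp add: D ceiling_le_iff)
    from X[OF this] obtain G :: "nat pair_pre_digraph" where G: "pair_graph G" "max_degree G \<le> D"
      "\<And>f. p_centered (int P) G f \<Longrightarrow> color_bound P (real D) \<le> real (num_colors G f)"
      by blast
    show "\<exists>G :: nat pair_pre_digraph. pair_graph G \<and> int (max_degree G) \<le> \<Delta> \<and>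
      (\<forall>f. p_centered p G f \<longrightarrow>
        real (num_colors G f) \<ge>
          1 / 10 ^ 6 * real_of_int \<Delta> powr (2 - 1 / real_of_int p) * real_of_int p *
          ln (real_of_int \<Delta>) powr (- 1 / real_of_int p))"
      using G by (intro exI[of _ G]) (simp add: D P(1) color_bound_def)
  qed
qed

end
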